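(* Let $K$ be a finite field with $|K|=q$ elements and $\mathrm{char}(K)\neq 2$, and let $T_{\mathrm{Sca}}(UJ_2)\subseteq J(X)$ be the set of all $\mathbb{Z}_2$-graded polynomial identities of $UJ_2=UJ_2(K)$ endowed with the scalar grading. Let $I'$ be the $T_{\mathbb{Z}_2}$-ideal of $J(X)$ generated by the polynomials \[(y_1,y_2,y_3),\quad (z_1,y_1,y_2),\quad (y_1,z_1,z_2),\quad z_1(z_2,z_3,z_4),\quad y_1^q-y_1,\quad (z_1^q-z_1)z_2.\] Then $I'=T_{\mathrm{Sca}}(UJ_2)$. Moreover, let $\widehat{S}\subseteq J(X)$ be the set of all polynomials of the forms (a) $Y_1'Z_1'$, (b) $Y_1'(z_{i_0}Z_1')$, where $Y_1'=y_1^{k_1}\cdots y_r^{k_r}$ with $r\geq 0$ and $0\leq k_i<q$ for all $i$; $Z_1'=(z_{i_1}z_{j_1})(z_{i_2}z_{j_2})\cdots(z_{i_t}z_{j_t})$ with $t\geq 0$, $i_1\leq j_1\leq i_2\leq j_2\leq\cdots\leq i_t\leq j_t$ and $0\leq\deg_{z_k}(Z_1')<q$ for all $k$; and $i_0\geq 1$. Then the elements $g+I'$, $g\in\widehat{S}$, form a basis of the quotient vector space $J(X)/I'$.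
   Context: $UT_2(K)$ is the associative algebra of $2\times 2$ upper triangular matrices over $K$ with usual product $\cdot$, and $UJ_2=UJ_2(K)$ is the same vector space with the Jordan product $u\circ v=\frac12(u\cdot v+v\cdot u)$, written $uv$. A $\mathbb{Z}_2$-grading is a decomposition $UJ_2=(UJ_2)_0\oplus (UJ_2)_1$ with $(UJ_2)_i\circ(UJ_2)_j\subseteq (UJ_2)_{i+j}$. The scalar grading is $(UJ_2)_0=\mathrm{span}\{e_{11}+e_{22}\}$, $(UJ_2)_1=\mathrm{span}\{e_{11}-e_{22},e_{12}\}$, where $e_{ij}$ are matrix units. $Y=\{y_1,y_2,\ldots\}$ and $Z=\{z_1,z_2,\ldots\}$ are disjoint infinite sets, $X=Y\cup Z$, and $J(X)$ is the free (unital) Jordan algebra over $K$ freely generated by $X$, with the $\mathbb{Z}_2$-grading in which each $y_i$ is even (degree $0$), each $z_i$ is odd (degree $1$), and the degree of a product of monomials is the sum of the degrees modulo $2$. A $T_{\mathbb{Z}_2}$-ideal is an ideal of $J(X)$ closed under all $\mathbb{Z}_2$-graded endomorphisms of $J(X)$; the $T_{\mathbb{Z}_2}$-ideal generated by a set is the smallest one containing it. An element $f(y_1,\ldots,y_s,z_1,\ldots,z_n)\in J(X)$ is a $\mathbb{Z}_2$-graded polynomial identity of $UJ_2$ if it vanishes under all substitutions of elements of $(UJ_2)_0$ for the $y_i$ and of elements of $(UJ_2)_1$ for the $z_i$. Associator: $(u,v,w)=(uv)w-u(vw)$. Products and powers without parentheses are left-normed: $f_1f_2\cdots f_n=(f_1\cdots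 f_{n-1})f_n$ (in $Z_1'$ the factors are the pairs $(z_{i_m}z_{j_m})$); the empty product is $1$. $\deg_{z_k}$ denotes the degree in the variable $z_k$. *)

theory Defs
  imports "HOL-Analysis.Analysis"
begin

section \<open>Unital Jordan algebras\<close>

text \<open>
  These are linear Jordan algebras (defined by the identities $ab = ba$ and
  $(a^2 b) a = a^2 (b a)$); the notion is only used in characteristic different from 2.
\<close>

locale unital_jordan_algebra = vector_space scale
  for scale :: "'k::field \<Rightarrow> 'a::ab_group_add \<Rightarrow> 'a" +
  fixes mult :: "'a \<Rightarrow> 'a \<Rightarrow> 'a" and unit :: 'a
  assumes mult_add_left: "mult (a + b) c = mult a c + mult b c"
    and mult_scale_left: "mult (scale s a) b = scale s (mult a b)"
    and mult_commute: "mult a b = mult b a"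
    and mult_unit: "mult unit a = a"
    and jordan_identity: "mult (mult (mult a a) b) a = mult (mult a a) (mult b a)"

definition unital_alg_hom ::
  "('k::field \<Rightarrow> 'a::ab_group_add \<Rightarrow> 'a) \<Rightarrow> ('a \<Rightarrow> 'a \<Rightarrow> 'a) \<Rightarrow> 'a \<Rightarrow>
   ('k \<Rightarrow> 'b::ab_group_add \<Rightarrow> 'b) \<Rightarrow> ('b \<Rightarrow> 'b \<Rightarrow> 'b) \<Rightarrow> 'b \<Rightarrow> ('a \<Rightarrow> 'b) \<Rightarrow> bool" where
  "unital_alg_hom sA mA uA sB mB uB \<phi> \<longleftrightarrow>
     Vector_Spaces.linear sA sB \<phi> \<and> (\<forall>a b. \<phi> (mA a b) = mB (\<phi> a) (\<phi> b)) \<and> \<phi> uA = uB"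


section \<open>The free unital Jordan algebra\<close>

text \<open>
  The variables are indexed from 0: \<open>VY i\<close> and \<open>VZ i\<close> stand for $y_{i+1}$ and $z_{i+1}$.

  The free algebra is the algebra of all terms in the operations of a unital $K$-algebra, modulo
  the congruence generated by the axioms of unital Jordan algebras; \<open>free_jordan_universal\<close>
  below is its universal property.
\<close>

datatype var = VY nat | VZ nat

datatype 'k jterm =
    TZero
  | TOne
  | TVar var
  | TAdd "'k jterm" "'k jterm"
  | TScale 'k "'k jterm"
  | TMult "'k jterm" "'k jterm"

inductive jeq :: "'k::field jterm \<Rightarrow> 'k jterm \<Rightarrow> bool" where
  refl: "jeq a a"
| sym: "jeq a b \<Longrightarrow> jeq b a"
| trans: "jeq a b \<Longrightarrow> jeq b c \<Longrightarrow> jeq a c"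
| cong_add: "jeq a a' \<Longrightarrow> jeq b b' \<Longrightarrow> jeq (TAdd a b) (TAdd a' b')"
| cong_scale: "jeq a a' \<Longrightarrow> jeq (TScale s a) (TScale s a')"
| cong_mult: "jeq a a' \<Longrightarrow> jeq b b' \<Longrightarrow> jeq (TMult a b) (TMult a' b')"
| add_assoc: "jeq (TAdd (TAdd a b) c) (TAdd a (TAdd b c))"
| add_commute: "jeq (TAdd a b) (TAdd b a)"
| add_zero: "jeq (TAdd TZero a) a"
| add_neg: "jeq (TAdd (TScale (- 1) a) a) TZero"
| scale_add: "jeq (TScale s (TAdd a b)) (TAdd (TScale s a) (TScale s b))"
| add_scale: "jeq (TScale (s + t) a) (TAdd (TScale s a) (TScale t a))"
| scale_scale: "jeq (TScale s (TScale t a)) (TScale (s * t) a)"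
| one_scale: "jeq (TScale 1 a) a"
| mult_add: "jeq (TMult (TAdd a b) c) (TAdd (TMult a c) (TMult b c))"
| mult_scale: "jeq (TMult (TScale s a) b) (TScale s (TMult a b))"
| mult_commute: "jeq (TMult a b) (TMult b a)"
| mult_one: "jeq (TMult TOne a) a"
| jordan: "jeq (TMult (TMult (TMult a a) b) a) (TMult (TMult a a) (TMult b a))"

quotient_type (overloaded) 'k jordan = "'k::field jterm" / jeq
  by (rule equivpI) (auto intro: reflpI sympI transpI jeq.refl jeq.sym jeq.trans)

instantiation jordan :: (field) ab_group_add
begin

lift_definition zero_jordan :: "'k::field jordan" is TZero .
lift_definition plus_jordan :: "'k::field jordan \<Rightarrow> 'k jordan \<Rightarrow> 'k jordan" is TAdd
  by (rule jeq.cong_add)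
lift_definition uminus_jordan :: "'k::field jordan \<Rightarrow> 'k jordan" is "TScale (- 1)"
  by (rule jeq.cong_scale)
definition minus_jordan :: "'k::field jordan \<Rightarrow> 'k jordan \<Rightarrow> 'k jordan" where
  "minus_jordan a b = a + (- b)"

instance
proof
  fix a b c :: "'k::field jordan"
  show "a + b + c = a + (b + c)" by transfer (rule jeq.add_assoc)
  show "a + b = b + a" by transfer (rule jeq.add_commute)
  show "0 + a = a" by transfer (rule jeq.add_zero)
  show "- a + a = 0" by transfer (rule jeq.add_neg)
  show "a - b = a + (- b)" by (rule minus_jordan_def)
qed

end

instantiation jordan :: (field) "{one, times}"
begin

lift_definition one_jordan :: "'k::field jordan" is TOne .
lift_definition times_jordan :: "'k::field jordan \<Rightarrow> 'k jordan \<Rightarrow> 'k jordan" is TMult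
  by (rule jeq.cong_mult)

instance ..

end

lift_definition jscale :: "'k::field \<Rightarrow> 'k jordan \<Rightarrow> 'k jordan" is TScale
  by (rule jeq.cong_scale)

lift_definition jvar :: "var \<Rightarrow> 'k::field jordan" is TVar .

abbreviation yv :: "nat \<Rightarrow> 'k::field jordan" where "yv i \<equiv> jvar (VY i)"
abbreviation zv :: "nat \<Rightarrow> 'k::field jordan" where "zv i \<equiv> jvar (VZ i)"

interpretation jordan: unital_jordan_algebra
  "jscale :: 'k::field \<Rightarrow> 'k jordan \<Rightarrow> 'k jordan" "(*)" 1
proof
  fix s t :: 'k and a b c :: "'k jordan"
  show "jscale s (a + b) = jscale s a + jscale s b" by transfer (rule jeq.scale_add)
  show "jscale (s + t) a = jscale s a + jscale t a" by transfer (rule jeq.add_scale)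
  show "jscale s (jscale t a) = jscale (s * t) a" by transfer (rule jeq.scale_scale)
  show "jscale 1 a = a" by transfer (rule jeq.one_scale)
  show "(a + b) * c = a * c + b * c" by transfer (rule jeq.mult_add)
  show "jscale s a * b = jscale s (a * b)" by transfer (rule jeq.mult_scale)
  show "a * b = b * a" by transfer (rule jeq.mult_commute)
  show "1 * a = a" by transfer (rule jeq.mult_one)
  show "a * a * b * a = a * a * (b * a)" by transfer (rule jeq.jordan)
qed

primrec jterm_eval ::
  "('k \<Rightarrow> 'b::ab_group_add \<Rightarrow> 'b) \<Rightarrow> ('b \<Rightarrow> 'b \<Rightarrow> 'b) \<Rightarrow> 'b \<Rightarrow> (var \<Rightarrow> 'b) \<Rightarrow> 'k jterm \<Rightarrow> 'b" where
  "jterm_eval sc mu u g TZero = 0"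
| "jterm_eval sc mu u g TOne = u"
| "jterm_eval sc mu u g (TVar x) = g x"
| "jterm_eval sc mu u g (TAdd a b) = jterm_eval sc mu u g a + jterm_eval sc mu u g b"
| "jterm_eval sc mu u g (TScale s a) = sc s (jterm_eval sc mu u g a)"
| "jterm_eval sc mu u g (TMult a b) = mu (jterm_eval sc mu u g a) (jterm_eval sc mu u g b)"

lemma jterm_eval_jeq:
  assumes "unital_jordan_algebra sc mu u" and "jeq a b"
  shows "jterm_eval sc mu u g a = jterm_eval sc mu u g b"
proof -
  interpret unital_jordan_algebra sc mu u by fact
  from assms(2) show ?thesis
    by (induction rule: jeq.induct)
      (simp_all add: add.assoc scale_right_distrib scale_left_distrib mult_add_left
        mult_scale_left mult_unit jordan_identity, simp_all add: add.commute mult_commute)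
qed

theorem free_jordan_universal:
  fixes sc :: "'k::field \<Rightarrow> 'b::ab_group_add \<Rightarrow> 'b"
  assumes "unital_jordan_algebra sc mu u"
  shows "\<exists>!\<phi>. unital_alg_hom jscale (*) 1 sc mu u \<phi> \<and> (\<forall>x. \<phi> (jvar x) = g x)"
proof (rule ex_ex1I)
  interpret unital_jordan_algebra sc mu u by fact
  define \<phi> where "\<phi> a = jterm_eval sc mu u g (rep_jordan a)" for a
  have \<phi>_abs: "\<phi> (abs_jordan t) = jterm_eval sc mu u g t" for t
    unfolding \<phi>_def
    by (rule jterm_eval_jeq[OF assms])
      (meson Quotient3_jordan jeq.refl rep_abs_rsp_left)
  have \<phi>_add: "\<phi> (a + b) = \<phi> a + \<phi> b" for a b
    by (induction a; induction b) (simp add: plus_jordan.abs_eq \<phi>_abs)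
  have \<phi>_mult: "\<phi> (a * b) = mu (\<phi> a) (\<phi> b)" for a b
    by (induction a; induction b) (simp add: times_jordan.abs_eq \<phi>_abs)
  have \<phi>_scale: "\<phi> (jscale s a) = sc s (\<phi> a)" for s a
    by (induction a) (simp add: jscale.abs_eq \<phi>_abs)
  have "Vector_Spaces.linear jscale sc \<phi>"
    by (simp add: Vector_Spaces.linear_iff \<phi>_add \<phi>_scale jordan.vector_space_axioms
        vector_space_axioms)
  then have "unital_alg_hom jscale (*) 1 sc mu u \<phi> \<and> (\<forall>x. \<phi> (jvar x) = g x)"
    by (simp add: unital_alg_hom_def \<phi>_mult one_jordan.abs_eq jvar.abs_eq \<phi>_abs)
  then show "\<exists>\<phi>. unital_alg_hom jscale (*) 1 sc mu u \<phi> \<and> (\<forall>x. \<phi> (jvar x) = g x)"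
    by (rule exI[of _ \<phi>])
next
  fix \<phi> \<psi> :: "'k jordan \<Rightarrow> 'b"
  have eval: "\<xi> (abs_jordan t) = jterm_eval sc mu u g t"
    if h: "unital_alg_hom jscale (*) 1 sc mu u \<xi> \<and> (\<forall>x. \<xi> (jvar x) = g x)" for \<xi> t
  proof -
    interpret h: Vector_Spaces.linear jscale sc \<xi> using h by (simp add: unital_alg_hom_def)
    show ?thesis
    proof (induction t)
      case TZero
      show ?case using h.zero by (simp add: zero_jordan.abs_eq)
    next
      case TOne
      show ?case using h by (simp add: unital_alg_hom_def flip: one_jordan.abs_eq)
    next
      case (TVar x)
      show ?case using h by (simp flip: jvar.abs_eq)
    next
      case (TAdd a b)
      then show ?case using h.add by (simp flip: plus_jordan.abs_eq)
    next
      case (TScale s a)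
      then show ?case using h.scale by (simp flip: jscale.abs_eq)
    next
      case (TMult a b)
      then show ?case using h by (simp add: unital_alg_hom_def flip: times_jordan.abs_eq)
    qed
  qed
  assume "unital_alg_hom jscale (*) 1 sc mu u \<phi> \<and> (\<forall>x. \<phi> (jvar x) = g x)"
    and "unital_alg_hom jscale (*) 1 sc mu u \<psi> \<and> (\<forall>x. \<psi> (jvar x) = g x)"
  then have "\<phi> a = \<psi> a" for a by (induction a) (simp add: eval)
  then show "\<phi> = \<psi>" ..
qed


section \<open>Monomials and the grading of the free algebra\<close>

datatype monom = MOne | MVar var | MMult monom monom

instantiation monom :: "{one, times}"
begin
definition one_monom :: monom where "one_monom = MOne"
definition times_monom :: "monom \<Rightarrow> monom \<Rightarrow> monom" where "times_monom = MMult"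
instance ..
end

primrec monom_val :: "monom \<Rightarrow> 'k::field jordan" where
  "monom_val MOne = 1"
| "monom_val (MVar x) = jvar x"
| "monom_val (MMult a b) = monom_val a * monom_val b"

primrec var_parity :: "var \<Rightarrow> nat" where
  "var_parity (VY i) = 0"
| "var_parity (VZ i) = 1"

primrec monom_parity :: "monom \<Rightarrow> nat" where
  "monom_parity MOne = 0"
| "monom_parity (MVar x) = var_parity x"
| "monom_parity (MMult a b) = (monom_parity a + monom_parity b) mod 2"

primrec monom_deg :: "var \<Rightarrow> monom \<Rightarrow> nat" where
  "monom_deg x MOne = 0"
| "monom_deg x (MVar x') = (if x' = x then 1 else 0)"
| "monom_deg x (MMult a b) = monom_deg x a + monom_deg x b"

definition jordan_comp :: "nat \<Rightarrow> 'k::field jordan set" where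
  "jordan_comp d = jordan.span {monom_val m | m. monom_parity m = d}"

fun lprod :: "'a::{one, times} list \<Rightarrow> 'a" where
  "lprod [] = 1"
| "lprod (x # xs) = foldl (*) x xs"

definition lpow :: "'a::{one, times} \<Rightarrow> nat \<Rightarrow> 'a" where
  "lpow x n = lprod (replicate n x)"

definition associator :: "'k::field jordan \<Rightarrow> 'k jordan \<Rightarrow> 'k jordan \<Rightarrow> 'k jordan" where
  "associator u v w = (u * v) * w - u * (v * w)"


section \<open>Graded T-ideals\<close>

definition graded_endo :: "('k::field jordan \<Rightarrow> 'k jordan) \<Rightarrow> bool" where
  "graded_endo \<phi> \<longleftrightarrow> unital_alg_hom jscale (*) 1 jscale (*) 1 \<phi> \<and>
     (\<forall>d \<in> {0, 1}. \<phi> ` jordan_comp d \<subseteq> jordan_comp d)"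

text \<open>As the product is commutative, one-sided ideals are two-sided.\<close>

definition jordan_ideal :: "'k::field jordan set \<Rightarrow> bool" where
  "jordan_ideal I \<longleftrightarrow> jordan.subspace I \<and> (\<forall>a\<in>I. \<forall>b. a * b \<in> I)"

definition graded_T_ideal :: "'k::field jordan set \<Rightarrow> bool" where
  "graded_T_ideal I \<longleftrightarrow> jordan_ideal I \<and> (\<forall>\<phi>. graded_endo \<phi> \<longrightarrow> \<phi> ` I \<subseteq> I)"

definition graded_T_ideal_gen :: "'k::field jordan set \<Rightarrow> 'k jordan set" where
  "graded_T_ideal_gen S = \<Inter> {I. graded_T_ideal I \<and> S \<subseteq> I}"

lemma graded_T_ideal_gen: "graded_T_ideal (graded_T_ideal_gen S)"
  unfolding graded_T_ideal_gen_def graded_T_ideal_def jordan_ideal_def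
    module.subspace_def[OF jordan.module_axioms]
  by blast

definition I' :: "'k::{field, finite} jordan set" where
  "I' = graded_T_ideal_gen
     {associator (yv 0) (yv 1) (yv 2),
      associator (zv 0) (yv 0) (yv 1),
      associator (yv 0) (zv 0) (zv 1),
      zv 0 * associator (zv 1) (zv 2) (zv 3),
      lpow (yv 0) CARD('k) - yv 0,
      (lpow (zv 0) CARD('k) - zv 0) * zv 1}"


section \<open>The Jordan algebra of upper triangular matrices with the scalar grading\<close>

definition mat_scale :: "'k::field \<Rightarrow> 'k^2^2 \<Rightarrow> 'k^2^2" where
  "mat_scale s A = (\<chi> i j. s * A $ i $ j)"

definition mat_jmult :: "'k::field^2^2 \<Rightarrow> 'k^2^2 \<Rightarrow> 'k^2^2" where
  "mat_jmult A B = mat_scale (1 / 2) (A ** B + B ** A)"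

interpretation mat: vector_space "mat_scale :: 'k::field \<Rightarrow> 'k^2^2 \<Rightarrow> 'k^2^2"
  by standard (simp_all add: mat_scale_def vec_eq_iff algebra_simps)

definition UJ2 :: "('k::field^2^2) set" where
  "UJ2 = {A. A $ 2 $ 1 = 0}"

text \<open>Matrix units: the row \<open>i\<close> is the \<open>j\<close>-th unit vector.\<close>

abbreviation mat_unit :: "2 \<Rightarrow> 2 \<Rightarrow> 'k::field^2^2" where
  "mat_unit i j \<equiv> axis i (axis j 1)"

definition UJ2_even :: "('k::field^2^2) set" where
  "UJ2_even = mat.span {mat_unit 1 1 + mat_unit 2 2}"

definition UJ2_odd :: "('k::field^2^2) set" where
  "UJ2_odd = mat.span {mat_unit 1 1 - mat_unit 2 2, mat_unit 1 2}"

text \<open>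
  Substituting elements of $UJ_2$ for the variables is applying the (by freeness, unique) unital
  homomorphism $J(X) \to UJ_2$ with the prescribed values on the variables.
\<close>

definition T_Sca :: "'k::field jordan set" where
  "T_Sca = {f. \<forall>\<phi>. unital_alg_hom jscale (*) 1 mat_scale mat_jmult (mat 1) \<phi> \<and> range \<phi> \<subseteq> UJ2 \<and>
                 (\<forall>i. \<phi> (yv i) \<in> UJ2_even) \<and> (\<forall>i. \<phi> (zv i) \<in> UJ2_odd) \<longrightarrow> \<phi> f = 0}"

lemma mat_unital_jordan_algebra:
  assumes "CHAR('k::field) \<noteq> 2"
  shows "unital_jordan_algebra (mat_scale :: 'k \<Rightarrow> _) mat_jmult (mat 1)"
proof -
  have two: "(2 :: 'k) \<noteq> 0"
    using assms CHAR_eq_posI[of 2, where ?'a = 'k] 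
    by (metis One_nat_def Suc_1 less_2_cases_iff of_nat_numeral of_nat_1 zero_less_numeral zero_neq_one neq0_conv)
  define h :: 'k where "h = 1 / 2"
  have h: "h * x + h * x = x" for x
    using two by (simp add: h_def field_simps flip: mult_2)
  have jm: "mat_jmult A B = mat_scale h (A ** B + B ** A)" for A B
    by (simp add: mat_jmult_def h_def)
  note entries = jm mat_scale_def matrix_matrix_mult_def mat_def vec_eq_iff sum_2 forall_2
  show ?thesis
  proof (unfold_locales, goal_cases)
    case (1 a b c) show ?case by (simp add: entries algebra_simps)
  next
    case (2 s a b) show ?case by (simp add: entries algebra_simps)
  next
    case (3 a b) show ?case by (simp add: entries algebra_simps)
  next
    case (4 a) show ?case by (simp add: entries distrib_left h)
  next
    case (5 a b)
    have "mat_scale s A ** B = mat_scale s (A ** B)" "A ** mat_scale s B = mat_scale s (A ** B)"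
      "(A + B) ** C = A ** C + B ** C" for s :: 'k and A B C :: "'k^2^2"
      by (simp_all add: entries algebra_simps)
    then show ?case
      by (simp only: jm matrix_add_ldistrib mat.scale_right_distrib mat.scale_scale
          matrix_mul_assoc ac_simps)
  qed
qed

lemma subspace_UJ2: "mat.subspace UJ2"
  by (simp add: mat.subspace_def UJ2_def mat_scale_def)

lemma UJ2_even_subset: "UJ2_even \<subseteq> UJ2" and UJ2_odd_subset: "UJ2_odd \<subseteq> UJ2"
  unfolding UJ2_even_def UJ2_odd_def
  by (rule mat.span_minimal[OF _ subspace_UJ2]; simp add: UJ2_def axis_def)+

lemma ex_graded_substitution:
  fixes g :: "var \<Rightarrow> 'k::field^2^2"
  assumes "CHAR('k) \<noteq> 2" and "\<And>i. g (VY i) \<in> UJ2_even" and "\<And>i. g (VZ i) \<in> UJ2_odd"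
  shows "\<exists>!\<phi>. unital_alg_hom jscale (*) 1 mat_scale mat_jmult (mat 1) \<phi> \<and> range \<phi> \<subseteq> UJ2 \<and>
    (\<forall>x. \<phi> (jvar x) = g x)"
proof -
  have g: "g x \<in> UJ2" for x
    using assms UJ2_even_subset UJ2_odd_subset by (cases x) auto
  have mem: "\<phi> (abs_jordan t) \<in> UJ2"
    if h: "unital_alg_hom jscale (*) 1 mat_scale mat_jmult (mat 1) \<phi>"
      and v: "\<And>x. \<phi> (jvar x) = g x" for \<phi> t
  proof -
    interpret h: Vector_Spaces.linear jscale mat_scale \<phi> using h by (simp add: unital_alg_hom_def)
    note U = UJ2_def mat_jmult_def mat_scale_def matrix_matrix_mult_def sum_2
    show ?thesis
    proof (induction t)
      case TZero
      show ?case using h.zero by (simp add: zero_jordan.abs_eq UJ2_def)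
    next
      case TOne
      show ?case using h by (simp add: unital_alg_hom_def UJ2_def mat_def flip: one_jordan.abs_eq)
    next
      case (TVar x)
      show ?case using v g by (simp flip: jvar.abs_eq)
    next
      case (TAdd a b)
      then show ?case by (simp add: h.add UJ2_def flip: plus_jordan.abs_eq)
    next
      case (TScale s a)
      then show ?case by (simp add: h.scale UJ2_def mat_scale_def flip: jscale.abs_eq)
    next
      case (TMult a b)
      moreover have "\<phi> (abs_jordan a * abs_jordan b) = mat_jmult (\<phi> (abs_jordan a)) (\<phi> (abs_jordan b))"
        using h by (simp add: unital_alg_hom_def)
      ultimately show ?case by (simp add: U flip: times_jordan.abs_eq)
    qed
  qed
  have "range \<phi> \<subseteq> UJ2"
    if "unital_alg_hom jscale (*) 1 mat_scale mat_jmult (mat 1) \<phi>"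
      and "\<And>x. \<phi> (jvar x) = g x" for \<phi>
  proof -
    have "\<phi> a \<in> UJ2" for a
      using that mem by (induction a) simp
    then show ?thesis by blast
  qed
  with free_jordan_universal[OF mat_unital_jordan_algebra[OF assms(1)], of g]
  show ?thesis by metis
qed


section \<open>The quotient vector space and the set of normal forms\<close>

lemma subspace_I': "jordan.subspace I'"
  using graded_T_ideal_gen unfolding I'_def graded_T_ideal_def jordan_ideal_def by blast

quotient_type (overloaded) 'k jordan_mod_I' =
  "'k::{field, finite} jordan" / "\<lambda>a b. a - b \<in> I'"
  morphisms rep_mod_I' coset_I'
proof (rule equivpI)
  show "reflp (\<lambda>a b :: 'k jordan. a - b \<in> I')"
    by (rule reflpI) (simp add: jordan.subspace_0[OF subspace_I'])
  show "symp (\<lambda>a b :: 'k jordan. a - b \<in> I')"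
    by (rule sympI) (metis jordan.subspace_neg[OF subspace_I'] minus_diff_eq)
  show "transp (\<lambda>a b :: 'k jordan. a - b \<in> I')"
  proof (rule transpI)
    fix a b c :: "'k jordan"
    assume "a - b \<in> I'" "b - c \<in> I'"
    then have "(a - b) + (b - c) \<in> I'" by (rule jordan.subspace_add[OF subspace_I'])
    then show "a - c \<in> I'" by simp
  qed
qed

instantiation jordan_mod_I' :: ("{field, finite}") ab_group_add
begin

lift_definition zero_jordan_mod_I' :: "'k::{field, finite} jordan_mod_I'" is 0 .
lift_definition plus_jordan_mod_I' ::
  "'k::{field, finite} jordan_mod_I' \<Rightarrow> 'k jordan_mod_I' \<Rightarrow> 'k jordan_mod_I'" is "(+)"
proof -
  fix a b c d :: "'k jordan"
  assume "a - b \<in> I'" "c - d \<in> I'"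
  then have "(a - b) + (c - d) \<in> I'" by (rule jordan.subspace_add[OF subspace_I'])
  then show "(a + c) - (b + d) \<in> I'" by (simp add: algebra_simps)
qed
lift_definition uminus_jordan_mod_I' ::
  "'k::{field, finite} jordan_mod_I' \<Rightarrow> 'k jordan_mod_I'" is uminus
proof -
  fix a b :: "'k jordan"
  assume "a - b \<in> I'"
  then have "- (a - b) \<in> I'" by (rule jordan.subspace_neg[OF subspace_I'])
  then show "- a - (- b) \<in> I'" by simp
qed
lift_definition minus_jordan_mod_I' ::
  "'k::{field, finite} jordan_mod_I' \<Rightarrow> 'k jordan_mod_I' \<Rightarrow> 'k jordan_mod_I'" is "(-)"
proof -
  fix a b c d :: "'k jordan"
  assume "a - b \<in> I'" "c - d \<in> I'"
  then have "(a - b) - (c - d) \<in> I'" by (rule jordan.subspace_diff[OF subspace_I'])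
  then show "(a - c) - (b - d) \<in> I'" by (simp add: algebra_simps)
qed

instance
  by standard (transfer; simp add: algebra_simps jordan.subspace_0[OF subspace_I'])+

end

lift_definition scale_mod_I' ::
  "'k::{field, finite} \<Rightarrow> 'k jordan_mod_I' \<Rightarrow> 'k jordan_mod_I'" is jscale
  by (metis jordan.subspace_scale[OF subspace_I'] jordan.scale_right_diff_distrib)

interpretation mod_I': vector_space
  "scale_mod_I' :: 'k::{field, finite} \<Rightarrow> 'k jordan_mod_I' \<Rightarrow> 'k jordan_mod_I'"
  by standard
    (transfer; simp add: algebra_simps jordan.scale_right_distrib jordan.scale_left_distrib
       jordan.subspace_0[OF subspace_I'])+

definition Y_part :: "nat \<Rightarrow> (nat \<Rightarrow> nat) \<Rightarrow> monom" where
  "Y_part r k = lprod (map (\<lambda>i. lpow (MVar (VY i)) (k i)) [0..<r])"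

definition Z_part :: "(nat \<times> nat) list \<Rightarrow> monom" where
  "Z_part ps = lprod (map (\<lambda>(i, j). MVar (VZ i) * MVar (VZ j)) ps)"

text \<open>\<open>sorted\<close> is weak: the condition below reads $i_1 \le j_1 \le i_2 \le j_2 \le \dots$\<close>

definition admissible_Y :: "nat \<Rightarrow> nat \<Rightarrow> (nat \<Rightarrow> nat) \<Rightarrow> bool" where
  "admissible_Y q r k \<longleftrightarrow> (\<forall>i<r. k i < q)"

definition admissible_Z :: "nat \<Rightarrow> (nat \<times> nat) list \<Rightarrow> bool" where
  "admissible_Z q ps \<longleftrightarrow>
     sorted (concat (map (\<lambda>(i, j). [i, j]) ps)) \<and> (\<forall>k. monom_deg (VZ k) (Z_part ps) < q)"

definition S_hat :: "'k::{field, finite} jordan set" where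
  "S_hat =
     {monom_val (Y_part r k * Z_part ps) | r k ps.
        admissible_Y CARD('k) r k \<and> admissible_Z CARD('k) ps} \<union>
     {monom_val (Y_part r k * (MVar (VZ i0) * Z_part ps)) | r k i0 ps.
        admissible_Y CARD('k) r k \<and> admissible_Z CARD('k) ps}"

end

theory Submission
  imports Defs
begin

text \<open>
  Modulo $I'$, associators with an even entry vanish. The even part of the quotient is therefore a
  commutative associative algebra, over which the odd part is a module generated by the $z_i$, and
  the last associator identity makes the products $(z_az_b)(z_cz_d)$ symmetric in all four
  letters. Hence every even monomial is the product of a monomial in the $y_i$ and a product of
  pairs that depends only on the multiset of the $z$-letters. The two identities involving $q$
  cut all exponents below $q$ (for the $z_k$ because $q$ is odd), so every monomial is congruent
  to a single element of $\widehat S$.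

  Conversely, substitute $y_i = \alpha_i 1$ and $z_i = b_i (e_{11} - e_{22}) + c_i e_{12}$. Elements
  of the first form become scalar matrices, elements of the second form become traceless, and their
  $e_{12}$-entries are linear in $c_{i_0}$. In both cases the coefficients are reduced monomials in
  the $\alpha_i$, $b_i$, which are linearly independent functions over a field with $q$ elements.
  So $\widehat S$ is independent modulo $T_{\mathrm{Sca}}(UJ_2) \supseteq I'$, and with the
  spanning property both ideals coincide.
\<close>

section \<open>Finite fields and reduced monomials\<close>

text \<open>Multiplication by a nonzero \<open>x\<close> permutes the nonzero elements, so comparing
  the product of all of them before and after gives \<open>x ^ (CARD('k) - 1) = 1\<close>.\<close>

lemma power_card_eq_self:
  fixes x :: "'k::{field, finite}"
  shows "x ^ CARD('k) = x"
proof (cases "x = 0")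
  case False
  have bij: "bij_betw ((*) x) (UNIV - {0}) (UNIV - {0})"
    by (rule bij_betwI[of _ _ _ "\<lambda>y. y / x"]) (use False in auto)
  have "prod id (UNIV - {0 :: 'k}) = (\<Prod>y\<in>UNIV - {0}. x * y)"
    using prod.reindex_bij_betw[OF bij, of id] by simp
  also have "\<dots> = x ^ (CARD('k) - 1) * prod id (UNIV - {0})"
    by (simp add: prod.distrib card_Diff_subset)
  finally have "x ^ (CARD('k) - 1) = 1"
    by (simp add: prod_zero_iff)
  moreover have "x ^ CARD('k) = x ^ (CARD('k) - 1) * x"
    using power_minus_mult[of "CARD('k)" x] by simp
  ultimately show ?thesis by simp
qed simp

lemma two_neq_zero:
  assumes "CHAR('k::field) \<noteq> 2"
  shows "(2 :: 'k) \<noteq> 0"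
  using assms CHAR_eq_posI[of 2, where ?'a = 'k]
  by (metis One_nat_def Suc_1 less_2_cases_iff of_nat_numeral of_nat_1 zero_less_numeral
      zero_neq_one neq0_conv)

text \<open>For even q the identity \<open>x ^ q = x\<close> at \<open>x = - 1\<close> would give
  \<open>- 1 = 1\<close>, which the characteristic excludes.\<close>

lemma odd_card:
  assumes "CHAR('k::{field, finite}) \<noteq> 2"
  shows "odd CARD('k)"
proof
  assume "even CARD('k)"
  then have "(- 1 :: 'k) = 1"
    using power_card_eq_self[of "- 1 :: 'k"] by simp
  then have "(2 :: 'k) = 0"
    by (metis add.right_inverse one_add_one)
  then show False
    using two_neq_zero[OF assms] by simp
qed

lemma one_less_card: "1 < CARD('k::{field, finite})"
proof -
  have "card {0, 1 :: 'k} \<le> CARD('k)" by (rule card_mono) auto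
  then show ?thesis by simp
qed

text \<open>Induction on the variables: with all values but that of \<open>v\<close> frozen, a
  polynomial in one variable of degree below q has q roots, so each of its coefficients is
  zero.\<close>

lemma reduced_monomials_independent:
  fixes c :: "'g \<Rightarrow> 'k::{field, finite}" and e :: "'g \<Rightarrow> 'v \<Rightarrow> nat"
  assumes "finite V" and "finite G"
    and "\<And>g i. g \<in> G \<Longrightarrow> i \<in> V \<Longrightarrow> e g i < CARD('k)"
    and "\<And>g h. g \<in> G \<Longrightarrow> h \<in> G \<Longrightarrow> (\<forall>i\<in>V. e g i = e h i) \<Longrightarrow> g = h"
    and "\<And>w. (\<Sum>g\<in>G. c g * (\<Prod>i\<in>V. w i ^ e g i)) = 0"
    and "g \<in> G"
  shows "c g = 0"
  using assms
proof (induction V arbitrary: G g rule: finite_induct)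
  case empty
  then have "G = {g}" by auto
  with empty.prems(4) show ?case by simp
next
  case (insert v V)
  \<comment> \<open>\<open>H\<close> collects the monomials contributing to the coefficient of
    \<open>v ^ e g v\<close>. The exponent of \<open>v\<close> is constant on \<open>H\<close>, so
    the remaining exponents still separate its elements.\<close>
  define H where "H = {h \<in> G. e h v = e g v}"
  show ?case
  proof (rule insert.IH)
    show "finite H" "g \<in> H" using insert.prems by (auto simp: H_def)
    show "e h i < CARD('k)" if "h \<in> H" "i \<in> V" for h i
      using that insert.prems(2) by (auto simp: H_def)
    show "h = h'" if "h \<in> H" "h' \<in> H" "\<forall>i\<in>V. e h i = e h' i" for h h'
      using that insert.prems(3) by (auto simp: H_def)
    fix w :: "'v \<Rightarrow> 'k"
    define p where "p = (\<Sum>h\<in>G. Polynomial.monom (c h * (\<Prod>i\<in>V. w i ^ e h i)) (e h v))"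
    have "poly p t = 0" for t
    proof -
      have "(\<Prod>i\<in>V. (w(v := t)) i ^ e h i) = (\<Prod>i\<in>V. w i ^ e h i)" for h
        by (rule prod.cong) (use insert.hyps(2) in auto)
      then show ?thesis
        using insert.prems(4)[of "w(v := t)"] insert.hyps
        by (simp add: p_def poly_sum poly_monom mult_ac)
    qed
    moreover have "degree p < CARD('k)"
    proof -
      have "degree p \<le> CARD('k) - 1"
        unfolding p_def
      proof (rule degree_sum_le[OF insert.prems(1)])
        fix h assume "h \<in> G"
        then have "e h v \<le> CARD('k) - 1" using insert.prems(2)[of h v] by simp
        then show "degree (Polynomial.monom (c h * (\<Prod>i\<in>V. w i ^ e h i)) (e h v)) \<le> CARD('k) - 1"
          using degree_monom_le order_trans by blast
      qed
      then show ?thesis using one_less_card[where 'k = 'k] by linarith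
    qed
    ultimately have "p = 0"
      using card_poly_roots_bound[of p] by fastforce
    then have "coeff p (e g v) = 0" by simp
    also have "coeff p (e g v) = (\<Sum>h\<in>H. c h * (\<Prod>i\<in>V. w i ^ e h i))"
      using insert.prems(1) by (simp add: p_def coeff_sum H_def sum.If_cases Int_def)
    finally show "(\<Sum>h\<in>H. c h * (\<Prod>i\<in>V. w i ^ e h i)) = 0" .
  qed
qed

section \<open>Degrees of the normal forms\<close>

lemma times_one_jordan: "(a :: 'k::field jordan) * 1 = a"
  by (metis jordan.mult_commute jordan.mult_unit)

lemma monom_val_foldl:
  "monom_val (foldl (*) m ms) = foldl (*) (monom_val m) (map monom_val ms)"
  by (induction ms arbitrary: m) (simp_all add: times_monom_def)

text \<open>Starting every left-normed product at 1 treats empty and nonempty products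
  alike.\<close>

lemma lprod_jordan: "lprod xs = foldl (*) 1 (xs :: 'k::field jordan list)"
  by (cases xs) (simp_all add: jordan.mult_unit)

lemma monom_val_lprod: "monom_val (lprod ms) = foldl (*) 1 (map monom_val ms)"
  by (cases ms) (simp_all add: jordan.mult_unit monom_val_foldl one_monom_def)

lemma lpow_jordan_0 [simp]: "lpow (x :: 'k::field jordan) 0 = 1"
  by (simp add: lpow_def)

lemma lpow_jordan_Suc [simp]: "lpow (x :: 'k::field jordan) (Suc n) = lpow x n * x"
  by (simp only: lpow_def lprod_jordan replicate_Suc replicate_append_same[symmetric] foldl_append)
    simp

lemma monom_val_lpow: "monom_val (lpow m n) = lpow (monom_val m) n"
  by (simp add: lpow_def monom_val_lprod lprod_jordan)

lemma monom_deg_foldl: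
  "monom_deg x (foldl (*) m ms) = monom_deg x m + sum_list (map (monom_deg x) ms)"
  by (induction ms arbitrary: m) (simp_all add: times_monom_def)

lemma monom_deg_lprod: "monom_deg x (lprod ms) = sum_list (map (monom_deg x) ms)"
  by (cases ms) (simp_all add: monom_deg_foldl one_monom_def)

lemma monom_deg_lpow: "monom_deg x (lpow m n) = n * monom_deg x m"
  by (simp add: lpow_def monom_deg_lprod sum_list_replicate)

lemma monom_parity_foldl:
  "monom_parity m = 0 \<Longrightarrow> \<forall>m'\<in>set ms. monom_parity m' = 0 \<Longrightarrow> monom_parity (foldl (*) m ms) = 0"
  by (induction ms arbitrary: m) (simp_all add: times_monom_def)

lemma monom_parity_lprod:
  "\<forall>m\<in>set ms. monom_parity m = 0 \<Longrightarrow> monom_parity (lprod ms) = 0"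
  by (cases ms) (simp_all add: monom_parity_foldl one_monom_def)

lemma monom_parity_Y_part: "monom_parity (Y_part r k) = 0"
  by (auto simp: Y_part_def lpow_def intro!: monom_parity_lprod)

lemma monom_parity_Z_part: "monom_parity (Z_part ps) = 0"
  by (auto simp: Z_part_def times_monom_def intro!: monom_parity_lprod)

lemma monom_deg_Y_part:
  "monom_deg (VY i) (Y_part r k) = (if i < r then k i else 0)"
  "monom_deg (VZ i) (Y_part r k) = 0"
proof -
  show "monom_deg (VZ i) (Y_part r k) = 0"
    by (simp add: Y_part_def monom_deg_lprod monom_deg_lpow o_def)
  have "monom_deg (VY i) (Y_part r k) = (\<Sum>j\<leftarrow>[0..<r]. if j = i then k i else 0)"
    by (auto simp: Y_part_def monom_deg_lprod monom_deg_lpow o_def intro!: arg_cong[of _ _ sum_list])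
  also have "\<dots> = (if i < r then k i else 0)"
    by (simp add: sum_list_distinct_conv_sum_set)
  finally show "monom_deg (VY i) (Y_part r k) = (if i < r then k i else 0)" .
qed

section \<open>Recovering a normal form from its degrees\<close>

definition unpair :: "('a \<times> 'a) list \<Rightarrow> 'a list" where
  "unpair ps = concat (map (\<lambda>(i, j). [i, j]) ps)"

lemma unpair_simps [simp]: "unpair [] = []" "unpair ((i, j) # ps) = i # j # unpair ps"
  by (simp_all add: unpair_def)

lemma monom_deg_Z_part:
  "monom_deg (VY i) (Z_part ps) = 0"
  "monom_deg (VZ i) (Z_part ps) = count (mset (unpair ps)) i"
  unfolding Z_part_def monom_deg_lprod
  by (induction ps) (auto simp: times_monom_def)

lemma unpair_inject: "unpair ps = unpair qs \<Longrightarrow> ps = qs"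
proof (induction ps arbitrary: qs)
  case Nil
  then show ?case by (cases qs) auto
next
  case (Cons p ps)
  then show ?case by (cases qs; cases p; cases "hd qs") auto
qed

lemma ex_unpair: "even (length xs) \<Longrightarrow> \<exists>ps. unpair ps = xs"
proof (induction xs rule: induct_list012)
  case 1
  have "unpair [] = []" by simp
  then show ?case by blast
next
  case (3 x y zs)
  then obtain ps where "unpair ps = zs" by auto
  then have "unpair ((x, y) # ps) = x # y # zs" by simp
  then show ?case by blast
qed simp

text \<open>The degrees determine neither \<open>r\<close> nor the values of \<open>k\<close> from
  \<open>r\<close> on, so only the values in the free algebra agree. Both products are extended to
  \<open>max r r'\<close> factors; the new ones have exponent 0 and are equal to 1.\<close>

lemma Y_part_eqI:
  assumes "\<And>x. monom_deg x (Y_part r k) = monom_deg x (Y_part r' k')"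
  shows "(monom_val (Y_part r k) :: 'k::field jordan) = monom_val (Y_part r' k')"
proof -
  define \<kappa> where "\<kappa> = (\<lambda>i. if i < r then k i else 0)"
  have \<kappa>: "\<kappa> = (\<lambda>i. if i < r' then k' i else 0)"
    using assms[of "VY _"] by (auto simp: \<kappa>_def monom_deg_Y_part)
  define P :: "nat \<Rightarrow> 'k jordan" where
    "P n = foldl (*) 1 (map (\<lambda>i. lpow (yv i) (\<kappa> i)) [0..<n])" for n
  have stable: "P n = P s" if "s \<le> n" "\<And>i. s \<le> i \<Longrightarrow> \<kappa> i = 0" for s n
    using that(1)
  proof (induction rule: dec_induct)
    case base
    show ?case ..
  next
    case (step n)
    then show ?case using that(2)[of n] by (simp add: P_def times_one_jordan)
  qed
  have "monom_val (Y_part r k) = P r"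
    by (auto simp: Y_part_def monom_val_lprod monom_val_lpow o_def P_def \<kappa>_def
        intro!: arg_cong[of _ _ "foldl (*) 1"])
  also have "\<dots> = P (max r r')"
    by (rule stable[symmetric]) (auto simp: \<kappa>_def)
  also have "\<dots> = P r'"
    by (rule stable) (auto simp: \<kappa>)
  also have "\<dots> = monom_val (Y_part r' k')"
    by (auto simp: Y_part_def monom_val_lprod monom_val_lpow o_def P_def \<kappa>
        intro!: arg_cong[of _ _ "foldl (*) 1"])
  finally show ?thesis .
qed

text \<open>The degrees give the multiset of letters, and a sorted list is recovered from its
  multiset.\<close>

lemma Z_part_eqI:
  assumes "\<And>x. monom_deg x (Z_part ps) = monom_deg x (Z_part qs)"
    and "sorted (unpair ps)" and "sorted (unpair qs)"
  shows "ps = qs"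
proof -
  have "mset (unpair ps) = mset (unpair qs)"
    using assms(1)[of "VZ _"] by (simp add: monom_deg_Z_part multiset_eq_iff)
  with assms(2,3) have "unpair ps = unpair qs"
    by (metis properties_for_sort sorted_sort_id)
  then show ?thesis by (rule unpair_inject)
qed

lemma YZ_part_eqI:
  assumes "\<And>x. monom_deg x (Y_part r k) + monom_deg x (Z_part ps)
      = monom_deg x (Y_part r' k') + monom_deg x (Z_part qs)"
    and "sorted (unpair ps)" and "sorted (unpair qs)"
  shows "(monom_val (Y_part r k) :: 'k::field jordan) = monom_val (Y_part r' k') \<and> ps = qs"
proof
  have "monom_deg x (Y_part r k) = monom_deg x (Y_part r' k')"
    "monom_deg x (Z_part ps) = monom_deg x (Z_part qs)" for x
    using assms(1)[of x] by (cases x; simp add: monom_deg_Y_part monom_deg_Z_part)+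
  then show "(monom_val (Y_part r k) :: 'k jordan) = monom_val (Y_part r' k')" "ps = qs"
    using Z_part_eqI[OF _ assms(2,3)] Y_part_eqI by blast+
qed

section \<open>Homogeneous components and graded endomorphisms\<close>

lemma subspace_jordan_comp: "jordan.subspace (jordan_comp d)"
  by (simp add: jordan_comp_def)

lemma monom_val_in_comp: "monom_val m \<in> jordan_comp (monom_parity m)"
  unfolding jordan_comp_def by (rule jordan.span_base) blast

lemma yv_in_comp: "yv i \<in> jordan_comp 0" and zv_in_comp: "zv i \<in> jordan_comp 1"
  using monom_val_in_comp[of "MVar (VY i)"] monom_val_in_comp[of "MVar (VZ i)"] by simp_all

lemma one_in_comp: "1 \<in> jordan_comp 0"
  using monom_val_in_comp[of MOne] by simp

lemma monom_parity_less: "monom_parity m < 2"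
proof (cases m)
  case (MVar x)
  then show ?thesis by (cases x) simp_all
qed simp_all

text \<open>The span contains 1 and the variables and is closed under products; closure is proved
  first for a monomial as left factor, then for any left factor from the span.\<close>

lemma span_monom_val: "jordan.span (range monom_val) = (UNIV :: 'k::field jordan set)"
proof -
  let ?S = "jordan.span (range monom_val) :: 'k jordan set"
  have mult: "monom_val m * a \<in> ?S" if "a \<in> ?S" for m a
    using that
  proof (induction rule: jordan.span_induct_alt)
    case base
    have "monom_val m * 0 = (0 :: 'k jordan)"
      by (metis jordan.mult_commute jordan.mult_scale_left jordan.scale_zero_left)
    then show ?case by (simp add: jordan.span_zero)
  next
    case (step s x y)
    then obtain m' where x: "x = monom_val m'" by blast
    have "monom_val m * (jscale s x + y) = jscale s (monom_val (MMult m m')) + monom_val m * y"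
      by (simp add: x jordan.mult_commute[of "monom_val m"] jordan.mult_add_left
          jordan.mult_scale_left)
    then show ?case
      using step by (metis jordan.span_add jordan.span_scale jordan.span_base rangeI)
  qed
  have mult: "b * a \<in> ?S" if "b \<in> ?S" "a \<in> ?S" for a b
    using that(1)
  proof (induction rule: jordan.span_induct_alt)
    case base
    have "0 * a = (0 :: 'k jordan)"
      by (metis jordan.mult_scale_left jordan.scale_zero_left)
    then show ?case by (simp add: jordan.span_zero)
  next
    case (step s x y)
    then show ?case
      using mult[OF that(2)]
      by (auto simp: jordan.mult_add_left jordan.mult_scale_left
          intro!: jordan.span_add jordan.span_scale)
  qed
  have "abs_jordan t \<in> ?S" for t
  proof (induction t)
    case TZero
    show ?case by (simp add: jordan.span_zero flip: zero_jordan.abs_eq)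
  next
    case TOne
    show ?case
      using jordan.span_base[OF rangeI[of monom_val MOne]]
      by (simp flip: one_jordan.abs_eq)
  next
    case (TVar x)
    show ?case
      using jordan.span_base[OF rangeI[of monom_val "MVar x"]]
      by (simp flip: jvar.abs_eq)
  next
    case (TAdd a b)
    then show ?case by (simp add: jordan.span_add flip: plus_jordan.abs_eq)
  next
    case (TScale s a)
    then show ?case by (simp add: jordan.span_scale flip: jscale.abs_eq)
  next
    case (TMult a b)
    then show ?case by (simp add: mult flip: times_jordan.abs_eq)
  qed
  then have "a \<in> ?S" for a by (induction a) simp
  then show ?thesis by blast
qed

lemma linear_image_comp:
  assumes "Vector_Spaces.linear jscale sc \<phi>" and "module.subspace sc S"
    and "\<And>m. monom_parity m = d \<Longrightarrow> \<phi> (monom_val m) \<in> S"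
  shows "\<phi> ` jordan_comp d \<subseteq> S"
proof -
  interpret \<phi>: Vector_Spaces.linear jscale sc \<phi> by fact
  have "\<phi> ` {monom_val m |m. monom_parity m = d} \<subseteq> S"
    using assms(3) by blast
  then have "\<phi>.vs2.span (\<phi> ` {monom_val m |m. monom_parity m = d}) \<subseteq> S"
    using assms(2) by (rule \<phi>.vs2.span_minimal)
  then show ?thesis
    by (simp add: jordan_comp_def \<phi>.span_image)
qed

text \<open>Bilinearity reduces the claim to monomials, one factor at a time.\<close>

lemma jordan_comp_mult:
  fixes a b :: "'k::field jordan"
  assumes "a \<in> jordan_comp d" and "b \<in> jordan_comp d'"
  shows "a * b \<in> jordan_comp ((d + d') mod 2)"
proof -
  let ?C = "jordan_comp ((d + d') mod 2) :: 'k jordan set"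
  have lin: "Vector_Spaces.linear jscale jscale (\<lambda>x :: 'k jordan. x * b)" for b
    by (simp add: Vector_Spaces.linear_iff jordan.vector_space_axioms jordan.mult_add_left
        jordan.mult_scale_left)
  have "monom_val m * b \<in> ?C" if "monom_parity m = d" for m
  proof -
    have "(\<lambda>x. x * monom_val m) ` jordan_comp d' \<subseteq> ?C"
    proof (rule linear_image_comp[OF lin subspace_jordan_comp])
      fix m' assume "monom_parity m' = d'"
      then show "monom_val m' * monom_val m \<in> ?C"
        using monom_val_in_comp[of "MMult m' m"] that by (simp add: add.commute)
    qed
    with assms(2) show ?thesis by (auto simp: jordan.mult_commute)
  qed
  then have "(\<lambda>x. x * b) ` jordan_comp d \<subseteq> ?C"
    by (rule linear_image_comp[OF lin subspace_jordan_comp])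
  with assms(1) show ?thesis by blast
qed

text \<open>By freeness the images of the variables may be prescribed. If these respect degrees, so
  does the whole homomorphism, by induction on monomials.\<close>

lemma ex_graded_endo:
  fixes u v :: "nat \<Rightarrow> 'k::field jordan"
  assumes "\<And>i. u i \<in> jordan_comp 0" and "\<And>i. v i \<in> jordan_comp 1"
  obtains \<phi> where "graded_endo \<phi>" and "\<And>i. \<phi> (yv i) = u i" and "\<And>i. \<phi> (zv i) = v i"
proof -
  define g where "g x = (case x of VY i \<Rightarrow> u i | VZ i \<Rightarrow> v i)" for x
  obtain \<phi> where hom: "unital_alg_hom jscale (*) 1 jscale (*) 1 \<phi>"
    and var: "\<And>x. \<phi> (jvar x) = g x"
    using free_jordan_universal[OF jordan.unital_jordan_algebra_axioms, of g] by blast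
  have "\<phi> (monom_val m) \<in> jordan_comp (monom_parity m)" for m
  proof (induction m)
    case MOne
    then show ?case using hom by (simp add: unital_alg_hom_def one_in_comp)
  next
    case (MVar x)
    then show ?case using assms by (cases x) (simp_all add: var g_def)
  next
    case (MMult m m')
    then show ?case using hom by (simp add: unital_alg_hom_def jordan_comp_mult)
  qed
  then have "\<phi> ` jordan_comp d \<subseteq> jordan_comp d" for d
    using hom unfolding unital_alg_hom_def
    by (intro linear_image_comp[OF _ subspace_jordan_comp]) auto
  with hom have "graded_endo \<phi>" by (simp add: graded_endo_def)
  then show ?thesis by (rule that) (simp_all add: var g_def)
qed

section \<open>Graded identities of the matrix algebra\<close>

text \<open>The general odd matrix b(e_11 - e_22) + c e_12.\<close>

definition odd_mat :: "'k::field \<Rightarrow> 'k \<Rightarrow> 'k^2^2" where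
  "odd_mat b c = vector [vector [b, c], vector [0, - b]]"

lemma odd_mat_nth [simp]:
  "odd_mat b c $ 1 $ 1 = b" "odd_mat b c $ 1 $ 2 = c"
  "odd_mat b c $ 2 $ 1 = 0" "odd_mat b c $ 2 $ 2 = - b"
  by (simp_all add: odd_mat_def)

lemma mat_nth [simp]:
  "(mat s :: 'k::field^2^2) $ 1 $ 1 = s" "(mat s :: 'k^2^2) $ 1 $ 2 = 0"
  "(mat s :: 'k^2^2) $ 2 $ 1 = 0" "(mat s :: 'k^2^2) $ 2 $ 2 = s"
  by (simp_all add: mat_def)

lemma mat_scale_nth [simp]: "mat_scale s A $ i $ j = s * A $ i $ j"
  by (simp add: mat_scale_def)

lemma UJ2_even_eq: "UJ2_even = range (mat :: 'k::field \<Rightarrow> 'k^2^2)"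
proof -
  have "mat_scale s (mat_unit 1 1 + mat_unit 2 2) = mat s" for s :: 'k
    by (simp add: vec_eq_iff forall_2 axis_def)
  then show ?thesis by (simp add: UJ2_even_def mat.span_singleton)
qed

lemma UJ2_odd_eq: "UJ2_odd = {odd_mat b c | b c :: 'k::field. True}"
proof -
  have *: "A = odd_mat b c \<longleftrightarrow>
      A - mat_scale b (mat_unit 1 1 - mat_unit 2 2) = mat_scale c (mat_unit 1 2)"
    for b c and A :: "'k^2^2"
    by (auto simp: vec_eq_iff forall_2 axis_def algebra_simps eq_neg_iff_add_eq_0)
  show ?thesis
    unfolding UJ2_odd_def mat.span_insert mat.span_empty * by auto
qed

text \<open>Since e_11 - e_22 and e_12 anticommute and e_12 squares to zero, the Jordan product of
  two odd matrices is scalar and depends only on their diagonals.\<close>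

lemma mat_jmult_simps:
  assumes "CHAR('k::field) \<noteq> 2"
  shows "mat_jmult (mat s) (mat t) = (mat (s * t) :: 'k^2^2)"
    and "mat_jmult (mat s) (odd_mat b c) = (odd_mat (s * b) (s * c) :: 'k^2^2)"
    and "mat_jmult (odd_mat b c) (mat s) = (odd_mat (s * b) (s * c) :: 'k^2^2)"
    and "mat_jmult (odd_mat b c) (odd_mat b' c') = (mat (b * b') :: 'k^2^2)"
  using two_neq_zero[OF assms]
  by (simp_all add: mat_jmult_def matrix_matrix_mult_def sum_2 vec_eq_iff forall_2 mult_ac)

definition graded_subst :: "('k::field jordan \<Rightarrow> 'k^2^2) \<Rightarrow> bool" where
  "graded_subst \<phi> \<longleftrightarrow> unital_alg_hom jscale (*) 1 mat_scale mat_jmult (mat 1) \<phi> \<and>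
     range \<phi> \<subseteq> UJ2 \<and> (\<forall>i. \<phi> (yv i) \<in> UJ2_even) \<and> (\<forall>i. \<phi> (zv i) \<in> UJ2_odd)"

lemma T_Sca_iff: "f \<in> T_Sca \<longleftrightarrow> (\<forall>\<phi>. graded_subst \<phi> \<longrightarrow> \<phi> f = 0)"
  by (simp add: T_Sca_def graded_subst_def)

lemma graded_subst_simps:
  assumes "graded_subst \<phi>"
  shows "\<phi> (a * b) = mat_jmult (\<phi> a) (\<phi> b)" "\<phi> 1 = mat 1" "\<phi> 0 = 0"
    "\<phi> (a + b) = \<phi> a + \<phi> b" "\<phi> (a - b) = \<phi> a - \<phi> b" "\<phi> (jscale s a) = mat_scale s (\<phi> a)"
    "\<phi> (\<Sum>i\<in>S. f i) = (\<Sum>i\<in>S. \<phi> (f i))"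
proof -
  interpret \<phi>: Vector_Spaces.linear jscale mat_scale \<phi>
    using assms by (simp add: graded_subst_def unital_alg_hom_def)
  show "\<phi> (a * b) = mat_jmult (\<phi> a) (\<phi> b)" "\<phi> 1 = mat 1"
    using assms by (simp_all add: graded_subst_def unital_alg_hom_def)
  show "\<phi> 0 = 0" "\<phi> (a + b) = \<phi> a + \<phi> b" "\<phi> (a - b) = \<phi> a - \<phi> b"
    "\<phi> (jscale s a) = mat_scale s (\<phi> a)" "\<phi> (\<Sum>i\<in>S. f i) = (\<Sum>i\<in>S. \<phi> (f i))"
    by (simp_all add: \<phi>.zero \<phi>.add \<phi>.diff \<phi>.scale \<phi>.sum)
qed

lemma graded_subst_var:
  assumes "graded_subst \<phi>"
  obtains \<alpha> b c where "\<And>i. \<phi> (yv i) = mat (\<alpha> i)" and "\<And>i. \<phi> (zv i) = odd_mat (b i) (c i)"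
proof -
  have "\<forall>i. \<exists>s. \<phi> (yv i) = mat s" "\<forall>i. \<exists>s t. \<phi> (zv i) = odd_mat s t"
    using assms by (auto simp: graded_subst_def UJ2_even_eq UJ2_odd_eq)
  then show ?thesis using that by metis
qed

lemma graded_subst_comp:
  assumes char: "CHAR('k::field) \<noteq> 2" and \<phi>: "graded_subst (\<phi> :: 'k jordan \<Rightarrow> _)"
  shows "\<phi> ` jordan_comp 0 \<subseteq> UJ2_even" "\<phi> ` jordan_comp 1 \<subseteq> UJ2_odd"
proof -
  obtain \<alpha> b c where var: "\<And>i. \<phi> (yv i) = mat (\<alpha> i)" "\<And>i. \<phi> (zv i) = odd_mat (b i) (c i)"
    using graded_subst_var[OF \<phi>] by metis
  have monom: "if monom_parity m = 0 then \<phi> (monom_val m) \<in> UJ2_even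
      else \<phi> (monom_val m) \<in> UJ2_odd" for m
  proof (induction m)
    case MOne
    then show ?case by (simp add: graded_subst_simps[OF \<phi>] UJ2_even_eq)
  next
    case (MVar x)
    then show ?case by (cases x) (auto simp: var UJ2_even_eq UJ2_odd_eq)
  next
    case (MMult m m')
    then show ?case
      using monom_parity_less[of m] monom_parity_less[of m']
      by (auto simp: graded_subst_simps[OF \<phi>] UJ2_even_eq UJ2_odd_eq mat_jmult_simps[OF char]
          less_2_cases_iff split: if_splits) blast+
  qed
  have lin: "Vector_Spaces.linear jscale mat_scale \<phi>"
    using \<phi> by (simp add: graded_subst_def unital_alg_hom_def)
  show "\<phi> ` jordan_comp 0 \<subseteq> UJ2_even"
    using monom unfolding UJ2_even_def
    by (intro linear_image_comp[OF lin mat.subspace_span]) metis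
  show "\<phi> ` jordan_comp 1 \<subseteq> UJ2_odd"
    using monom unfolding UJ2_odd_def
    by (intro linear_image_comp[OF lin mat.subspace_span]) (metis zero_neq_one)
qed

lemma graded_T_ideal_T_Sca:
  assumes char: "CHAR('k::field) \<noteq> 2"
  shows "graded_T_ideal (T_Sca :: 'k jordan set)"
proof -
  have "jordan.subspace (T_Sca :: 'k jordan set)"
    by (auto simp: jordan.subspace_def T_Sca_iff graded_subst_simps) (metis add_0)
  moreover have "mat_jmult 0 A = (0 :: 'k^2^2)" for A
    by (simp add: mat_jmult_def matrix_matrix_mult_def vec_eq_iff)
  then have "a * b \<in> T_Sca" if "a \<in> T_Sca" for a b :: "'k jordan"
    using that by (metis T_Sca_iff graded_subst_simps(1))
  moreover have "\<psi> a \<in> T_Sca" if \<psi>: "graded_endo \<psi>" and a: "a \<in> T_Sca" for \<psi> and a :: "'k jordan"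
    unfolding T_Sca_iff
  proof (intro allI impI)
    fix \<phi> :: "'k jordan \<Rightarrow> 'k^2^2" assume \<phi>: "graded_subst \<phi>"
    have "Vector_Spaces.linear jscale jscale \<psi>"
      using \<psi> by (simp add: graded_endo_def unital_alg_hom_def)
    moreover have "\<psi> (yv i) \<in> jordan_comp 0" "\<psi> (zv i) \<in> jordan_comp 1" for i
      using \<psi> yv_in_comp zv_in_comp unfolding graded_endo_def by blast+
    \<comment> \<open>The variables keep their degrees under \<open>\<psi>\<close>, so following it
      by \<open>\<phi>\<close> is again a substitution that respects the grading.\<close>
    ultimately have "graded_subst (\<phi> \<circ> \<psi>)"
      using \<phi> \<psi> graded_subst_comp[OF char \<phi>]
      by (auto simp: graded_subst_def graded_endo_def unital_alg_hom_def
          intro: Vector_Spaces.linear_compose)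
    with a show "\<phi> (\<psi> a) = 0" by (metis T_Sca_iff comp_apply)
  qed
  ultimately show ?thesis by (auto simp: graded_T_ideal_def jordan_ideal_def)
qed

text \<open>As \<open>T_Sca\<close> is itself a graded T-ideal, only the six generators have to be
  evaluated.\<close>

lemma I'_subset_T_Sca:
  assumes char: "CHAR('k::{field, finite}) \<noteq> 2"
  shows "(I' :: 'k jordan set) \<subseteq> T_Sca"
  unfolding I'_def graded_T_ideal_gen_def
proof (rule Inter_lower, intro CollectI conjI subsetI)
  show "graded_T_ideal (T_Sca :: 'k jordan set)" by (rule graded_T_ideal_T_Sca[OF char])
  fix f :: "'k jordan"
  assume f: "f \<in> {associator (yv 0) (yv 1) (yv 2),
      associator (zv 0) (yv 0) (yv 1),
      associator (yv 0) (zv 0) (zv 1),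
      zv 0 * associator (zv 1) (zv 2) (zv 3),
      lpow (yv 0) CARD('k) - yv 0,
      (lpow (zv 0) CARD('k) - zv 0) * zv 1}"
  show "f \<in> T_Sca"
    unfolding T_Sca_iff
  proof (intro allI impI)
    fix \<phi> :: "'k jordan \<Rightarrow> 'k^2^2" assume \<phi>: "graded_subst \<phi>"
    obtain \<alpha> b c where var: "\<And>i. \<phi> (yv i) = mat (\<alpha> i)" "\<And>i. \<phi> (zv i) = odd_mat (b i) (c i)"
      using graded_subst_var[OF \<phi>] by metis
    note simps = graded_subst_simps[OF \<phi>] var mat_jmult_simps[OF char]
    have even_pow: "\<phi> (lpow (yv i) n) = mat (\<alpha> i ^ n)" for i n
      by (induction n) (simp_all add: simps mult.commute)
    have odd_pow: "\<phi> (lpow (zv i) (2 * n)) = mat (b i ^ (2 * n))" for i n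
      by (induction n) (simp_all add: simps mult_ac)
    have odd_pow': "\<phi> (lpow (zv i) (2 * n + 1)) = odd_mat (b i ^ (2 * n + 1)) (b i ^ (2 * n) * c i)"
      for i n
      using odd_pow[of i n] by (simp add: simps mult_ac)
    obtain n where n: "CARD('k) = 2 * n + 1"
      using odd_card[OF char] by (rule oddE)
    \<comment> \<open>The matrix of \<open>z^q\<close> has the diagonal of that of \<open>z\<close>,
      but possibly another (1,2)-entry. So \<open>z^q - z\<close> becomes a multiple of e_12, which
      a further odd factor annihilates.\<close>
    have "\<phi> (lpow (zv i) CARD('k)) = odd_mat (b i) (b i ^ (2 * n) * c i)" for i
      using odd_pow'[of i n] power_card_eq_self[of "b i"] by (simp only: n)
    moreover have "\<phi> (lpow (yv i) CARD('k)) = mat (\<alpha> i)" for i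
      by (simp add: even_pow power_card_eq_self)
    moreover have "odd_mat s t - odd_mat s' t' = odd_mat (s - s') (t - t')" for s t s' t' :: 'k
      by (simp add: vec_eq_iff forall_2)
    moreover have "mat 0 = (0 :: 'k^2^2)"
      by (simp add: vec_eq_iff forall_2)
    moreover have "odd_mat 0 0 = (0 :: 'k^2^2)"
      by (simp add: vec_eq_iff forall_2)
    ultimately show "\<phi> f = 0"
      using f by (auto simp: associator_def simps mult_ac)
  qed
qed

section \<open>The quotient algebra\<close>

lemma I'_mult:
  assumes "a \<in> I'"
  shows "a * b \<in> I'" "b * a \<in> I'"
  using assms graded_T_ideal_gen unfolding I'_def graded_T_ideal_def jordan_ideal_def
  by (metis jordan.mult_commute)+

lemma diff_mult_jordan: "(a - b) * c = a * c - b * (c :: 'k::field jordan)"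
  by (metis add_diff_cancel diff_add_cancel jordan.mult_add_left)

text \<open>No ring class is instantiated: associativity will be shown only for triples of
  homogeneous elements whose first entry is even.\<close>

instantiation jordan_mod_I' :: ("{field, finite}") "{one, times}"
begin

lift_definition one_jordan_mod_I' :: "'k::{field, finite} jordan_mod_I'" is 1 .

lift_definition times_jordan_mod_I' ::
  "'k::{field, finite} jordan_mod_I' \<Rightarrow> 'k jordan_mod_I' \<Rightarrow> 'k jordan_mod_I'" is "(*)"
proof -
  fix a b c d :: "'k jordan"
  assume "a - b \<in> I'" "c - d \<in> I'"
  then have "(a - b) * c + b * (c - d) \<in> I'"
    by (intro jordan.subspace_add[OF subspace_I'] I'_mult)
  then show "a * c - b * d \<in> I'"
    by (simp add: diff_mult_jordan jordan.mult_commute[of b])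
qed

instance ..

end

lemma coset_I'_eq_iff: "coset_I' a = coset_I' b \<longleftrightarrow> a - b \<in> I'"
  by (rule jordan_mod_I'.abs_eq_iff)

lemma coset_I'_mult: "coset_I' (a * b) = coset_I' a * coset_I' b"
  and coset_I'_one: "coset_I' 1 = 1"
  by (simp_all add: times_jordan_mod_I'.abs_eq one_jordan_mod_I'.abs_eq)

lemma linear_coset_I': "Vector_Spaces.linear jscale scale_mod_I' coset_I'"
  by (simp add: Vector_Spaces.linear_iff jordan.vector_space_axioms mod_I'.vector_space_axioms
      plus_jordan_mod_I'.abs_eq scale_mod_I'.abs_eq)

lemma mult_commute_mod_I': "(a :: 'k::{field, finite} jordan_mod_I') * b = b * a"
  by (induction a; induction b) (metis coset_I'_mult jordan.mult_commute)

lemma one_mult_mod_I': "1 * (a :: 'k::{field, finite} jordan_mod_I') = a"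
  by (induction a) (metis coset_I'_mult coset_I'_one jordan.mult_unit)

definition comp_mod_I' :: "nat \<Rightarrow> 'k::{field, finite} jordan_mod_I' set" where
  "comp_mod_I' d = coset_I' ` jordan_comp d"

lemma comp_mod_I'_mult:
  assumes "a \<in> comp_mod_I' d" and "b \<in> comp_mod_I' d'"
  shows "a * b \<in> comp_mod_I' ((d + d') mod 2)"
  using assms jordan_comp_mult[of _ d _ d'] unfolding comp_mod_I'_def
  by (metis (no_types, lifting) coset_I'_mult image_iff)

lemmas comp_mod_I'_mults =
  comp_mod_I'_mult[of _ 0 _ 0, simplified] comp_mod_I'_mult[of _ 0 _ 1, simplified]
  comp_mod_I'_mult[of _ 1 _ 0, simplified] comp_mod_I'_mult[of _ 1 _ 1, simplified]

section \<open>Substitution instances of the generators of \<open>I'\<close>\<close>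

lemma I'_graded_endo: "graded_endo \<phi> \<Longrightarrow> f \<in> I' \<Longrightarrow> \<phi> f \<in> I'"
  using graded_T_ideal_gen unfolding I'_def graded_T_ideal_def by blast

lemma I'_generators:
  "associator (yv 0) (yv 1) (yv 2) \<in> (I' :: 'k::{field, finite} jordan set)"
  "associator (zv 0) (yv 0) (yv 1) \<in> (I' :: 'k jordan set)"
  "associator (yv 0) (zv 0) (zv 1) \<in> (I' :: 'k jordan set)"
  "zv 0 * associator (zv 1) (zv 2) (zv 3) \<in> (I' :: 'k jordan set)"
  "lpow (yv 0) CARD('k) - yv 0 \<in> (I' :: 'k jordan set)"
  "(lpow (zv 0) CARD('k) - zv 0) * zv 1 \<in> (I' :: 'k jordan set)"
  unfolding I'_def graded_T_ideal_gen_def by blast+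

text \<open>Closure of \<open>I'\<close> under graded endomorphisms in usable form: the six
  generators involve at most three even and four odd variables, whose images are prescribed here
  once for all of them.\<close>

lemma ex_I'_subst:
  fixes a b c p q r s :: "'k::{field, finite} jordan"
  assumes "{a, b, c} \<subseteq> jordan_comp 0" and "{p, q, r, s} \<subseteq> jordan_comp 1"
  obtains \<phi> :: "'k jordan \<Rightarrow> 'k jordan"
  where "\<And>x y. \<phi> (x * y) = \<phi> x * \<phi> y" and "\<And>x y. \<phi> (x - y) = \<phi> x - \<phi> y" and "\<phi> 1 = 1"
    and "\<phi> (yv 0) = a" "\<phi> (yv 1) = b" "\<phi> (yv 2) = c"
    and "\<phi> (zv 0) = p" "\<phi> (zv 1) = q" "\<phi> (zv 2) = r" "\<phi> (zv 3) = s"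
    and "\<And>f. f \<in> I' \<Longrightarrow> \<phi> f \<in> I'"
proof -
  obtain \<phi> :: "'k jordan \<Rightarrow> 'k jordan" where \<phi>: "graded_endo \<phi>"
    "\<And>i. \<phi> (yv i) = (if i = 0 then a else if i = 1 then b else c)"
    "\<And>i. \<phi> (zv i) = (if i = 0 then p else if i = 1 then q else if i = 2 then r else s)"
    using assms
    by (rule_tac ex_graded_endo[where u = "\<lambda>i. if i = 0 then a else if i = 1 then b else c"
          and v = "\<lambda>i. if i = 0 then p else if i = 1 then q else if i = 2 then r else s"]) auto
  interpret \<phi>: Vector_Spaces.linear jscale jscale \<phi>
    using \<phi>(1) by (simp add: graded_endo_def unital_alg_hom_def)
  show ?thesis
    by (rule that[of \<phi>])
      (use \<phi> I'_graded_endo in \<open>auto simp: graded_endo_def unital_alg_hom_def \<phi>.diff\<close>)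
qed

lemma zero_in_comp: "0 \<in> jordan_comp d"
  by (rule jordan.subspace_0[OF subspace_jordan_comp])

lemma associator_in_I':
  fixes a b c :: "'k::{field, finite} jordan"
  shows "\<lbrakk>a \<in> jordan_comp 0; b \<in> jordan_comp 0; c \<in> jordan_comp 0\<rbrakk> \<Longrightarrow> associator a b c \<in> I'"
    and "\<lbrakk>a \<in> jordan_comp 1; b \<in> jordan_comp 0; c \<in> jordan_comp 0\<rbrakk> \<Longrightarrow> associator a b c \<in> I'"
    and "\<lbrakk>a \<in> jordan_comp 0; b \<in> jordan_comp 1; c \<in> jordan_comp 1\<rbrakk> \<Longrightarrow> associator a b c \<in> I'"
proof -
  show "associator a b c \<in> I'" if h: "a \<in> jordan_comp 0" "b \<in> jordan_comp 0" "c \<in> jordan_comp 0"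
  proof -
    obtain \<phi> :: "'k jordan \<Rightarrow> 'k jordan" where
      \<phi>: "\<And>x y. \<phi> (x * y) = \<phi> x * \<phi> y" "\<And>x y. \<phi> (x - y) = \<phi> x - \<phi> y"
      "\<phi> (yv 0) = a" "\<phi> (yv 1) = b" "\<phi> (yv 2) = c" "\<And>f. f \<in> I' \<Longrightarrow> \<phi> f \<in> I'"
      \<comment> \<open>Variables that do not occur in the generator go to 0, which lies in every
        component.\<close>
      using h by (rule_tac ex_I'_subst[of a b c 0 0 0 0]) (auto simp: zero_in_comp)
    show ?thesis using \<phi>(6)[OF I'_generators(1)] by (simp add: associator_def \<phi>(1-5) del: One_nat_def)
  qed
  show "associator a b c \<in> I'" if h: "a \<in> jordan_comp 1" "b \<in> jordan_comp 0" "c \<in> jordan_comp 0"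
  proof -
    obtain \<phi> :: "'k jordan \<Rightarrow> 'k jordan" where
      \<phi>: "\<And>x y. \<phi> (x * y) = \<phi> x * \<phi> y" "\<And>x y. \<phi> (x - y) = \<phi> x - \<phi> y"
      "\<phi> (zv 0) = a" "\<phi> (yv 0) = b" "\<phi> (yv 1) = c" "\<And>f. f \<in> I' \<Longrightarrow> \<phi> f \<in> I'"
      using h by (rule_tac ex_I'_subst[of b c 0 a 0 0 0]) (auto simp: zero_in_comp)
    show ?thesis using \<phi>(6)[OF I'_generators(2)] by (simp add: associator_def \<phi>(1-5) del: One_nat_def)
  qed
  show "associator a b c \<in> I'" if h: "a \<in> jordan_comp 0" "b \<in> jordan_comp 1" "c \<in> jordan_comp 1"
  proof -
    obtain \<phi> :: "'k jordan \<Rightarrow> 'k jordan" where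
      \<phi>: "\<And>x y. \<phi> (x * y) = \<phi> x * \<phi> y" "\<And>x y. \<phi> (x - y) = \<phi> x - \<phi> y"
      "\<phi> (yv 0) = a" "\<phi> (zv 0) = b" "\<phi> (zv 1) = c" "\<And>f. f \<in> I' \<Longrightarrow> \<phi> f \<in> I'"
      using h by (rule_tac ex_I'_subst[of a 0 0 b c 0 0]) (auto simp: zero_in_comp)
    show ?thesis using \<phi>(6)[OF I'_generators(3)] by (simp add: associator_def \<phi>(1-5) del: One_nat_def)
  qed
qed

lemma odd_mult_associator_in_I':
  fixes a b c d :: "'k::{field, finite} jordan"
  assumes "a \<in> jordan_comp 1" "b \<in> jordan_comp 1" "c \<in> jordan_comp 1" "d \<in> jordan_comp 1"
  shows "a * associator b c d \<in> I'"
proof -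
  obtain \<phi> :: "'k jordan \<Rightarrow> 'k jordan" where
      \<phi>: "\<And>x y. \<phi> (x * y) = \<phi> x * \<phi> y" "\<And>x y. \<phi> (x - y) = \<phi> x - \<phi> y"
    "\<phi> (zv 0) = a" "\<phi> (zv 1) = b" "\<phi> (zv 2) = c" "\<phi> (zv 3) = d" "\<And>f. f \<in> I' \<Longrightarrow> \<phi> f \<in> I'"
    using assms by (rule_tac ex_I'_subst[of 0 0 0 a b c d]) (auto simp: zero_in_comp)
  show ?thesis using \<phi>(7)[OF I'_generators(4)] by (simp add: associator_def \<phi>(1-6) del: One_nat_def)
qed

lemma lpow_card_in_I':
  fixes a b :: "'k::{field, finite} jordan"
  shows "a \<in> jordan_comp 0 \<Longrightarrow> lpow a CARD('k) - a \<in> I'"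
    and "\<lbrakk>a \<in> jordan_comp 1; b \<in> jordan_comp 1\<rbrakk> \<Longrightarrow> (lpow a CARD('k) - a) * b \<in> I'"
proof -
  have pow: "\<phi> (lpow x n) = lpow (\<phi> x) n"
    if "\<And>x y. \<phi> (x * y) = \<phi> x * \<phi> y" "\<phi> 1 = 1" for \<phi> :: "'k jordan \<Rightarrow> 'k jordan" and x n
    using that by (induction n) simp_all
  show "lpow a CARD('k) - a \<in> I'" if a: "a \<in> jordan_comp 0"
  proof -
    obtain \<phi> :: "'k jordan \<Rightarrow> 'k jordan" where
      \<phi>: "\<And>x y. \<phi> (x * y) = \<phi> x * \<phi> y" "\<And>x y. \<phi> (x - y) = \<phi> x - \<phi> y" "\<phi> 1 = 1"
      "\<phi> (yv 0) = a" "\<And>f. f \<in> I' \<Longrightarrow> \<phi> f \<in> I'"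
      using a by (rule_tac ex_I'_subst[of a 0 0 0 0 0 0]) (auto simp: zero_in_comp)
    show ?thesis using \<phi>(5)[OF I'_generators(5)] by (simp add: pow[OF \<phi>(1,3)] \<phi>(2,4))
  qed
  show "(lpow a CARD('k) - a) * b \<in> I'" if h: "a \<in> jordan_comp 1" "b \<in> jordan_comp 1"
  proof -
    obtain \<phi> :: "'k jordan \<Rightarrow> 'k jordan" where
      \<phi>: "\<And>x y. \<phi> (x * y) = \<phi> x * \<phi> y" "\<And>x y. \<phi> (x - y) = \<phi> x - \<phi> y" "\<phi> 1 = 1"
      "\<phi> (zv 0) = a" "\<phi> (zv 1) = b" "\<And>f. f \<in> I' \<Longrightarrow> \<phi> f \<in> I'"
      using h by (rule_tac ex_I'_subst[of 0 0 0 a b 0 0]) (auto simp: zero_in_comp)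
    show ?thesis
      using \<phi>(6)[OF I'_generators(6)] by (simp add: pow[OF \<phi>(1,3)] \<phi>(1,2,4,5) del: One_nat_def)
  qed
qed

text \<open>The generators cover the parity patterns (0,0,0), (1,0,0) and (0,1,1). Reversing an
  associator only changes its sign, which yields (0,0,1); the pattern (0,1,0) remains.\<close>

lemma assoc_mod_I':
  assumes "a \<in> comp_mod_I' 0" and "b \<in> comp_mod_I' 0 \<union> comp_mod_I' 1" 
    and "c \<in> comp_mod_I' 0 \<union> comp_mod_I' 1"
  shows "a * b * c = a * (b * c)"
proof -
  have eqI: "coset_I' x * coset_I' y * coset_I' z = coset_I' x * (coset_I' y * coset_I' z)"
    if "associator x y z \<in> I'" for x y z
    using that by (metis associator_def coset_I'_eq_iff coset_I'_mult)
  have e: "x * y * z = x * (y * z)"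
    if "x \<in> comp_mod_I' 0" "y \<in> comp_mod_I' d" "z \<in> comp_mod_I' d" "d = 0 \<or> d = 1" for x y z d
    using that(4) that(1-3)
    by (elim disjE) (auto simp: comp_mod_I'_def intro!: eqI intro: associator_in_I')
  have o: "z * y * x = z * (y * x)"
    if "x \<in> comp_mod_I' 0" "y \<in> comp_mod_I' 0" "z \<in> comp_mod_I' 1" for x y z
    using that by (auto simp: comp_mod_I'_def intro!: eqI intro: associator_in_I')
  from assms consider "b \<in> comp_mod_I' 0" "c \<in> comp_mod_I' 0" | "b \<in> comp_mod_I' 1" "c \<in> comp_mod_I' 1"
    | "b \<in> comp_mod_I' 0" "c \<in> comp_mod_I' 1" | "b \<in> comp_mod_I' 1" "c \<in> comp_mod_I' 0"
    by blast
  then show ?thesis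
  proof cases
    case 1
    with e assms show ?thesis by blast
  next
    case 2
    with e assms show ?thesis by blast
  next
    case 3
    then show ?thesis using o[OF assms(1) 3] by (metis mult_commute_mod_I')
  next
    case 4
    \<comment> \<open>By commutativity, \<open>(a, b, c) = (b, a, c) - (b, c, a)\<close>.\<close>
    then show ?thesis
      using o[OF assms(1) 4(2,1)] o[OF 4(2) assms(1) 4(1)] by (metis mult_commute_mod_I')
  qed
qed

text \<open>The vanishing of \<open>a(b, c, d)\<close> says \<open>a((bc)d) = a(b(cd))\<close>.
  Since \<open>bc\<close> and \<open>cd\<close> are even, they can be taken out, leaving
  \<open>(bc)(ad) = (cd)(ab)\<close>.\<close>

lemma odd_mult_symmetric:
  assumes "a \<in> comp_mod_I' 1" "b \<in> comp_mod_I' 1" "c \<in> comp_mod_I' 1" "d \<in> comp_mod_I' 1"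
  shows "(a * b) * (c * d) = (a * d) * (b * c)"
proof -
  have "a * (b * c * d) = a * (b * (c * d))"
  proof -
    obtain a' b' c' d' where *: "a = coset_I' a'" "b = coset_I' b'" "c = coset_I' c'"
      "d = coset_I' d'" "a' \<in> jordan_comp 1" "b' \<in> jordan_comp 1" "c' \<in> jordan_comp 1"
      "d' \<in> jordan_comp 1"
      using assms by (auto simp: comp_mod_I'_def)
    have "a' * (b' * c' * d') - a' * (b' * (c' * d')) \<in> I'"
      using odd_mult_associator_in_I'[OF *(5-8)]
      by (simp add: associator_def diff_mult_jordan jordan.mult_commute[of a'])
    then show ?thesis
      unfolding * by (simp only: coset_I'_eq_iff[symmetric] coset_I'_mult)
  qed
  moreover have "b * c \<in> comp_mod_I' 0" "c * d \<in> comp_mod_I' 0"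
    using assms by (simp_all add: comp_mod_I'_mults)
  ultimately show ?thesis
    using assms assoc_mod_I'[of "b * c" d a] assoc_mod_I'[of "c * d" b a]
    by (metis UnI2 mult_commute_mod_I')
qed

section \<open>The commutative monoid of even elements of the quotient\<close>

text \<open>A separate type for the even part can be an instance of \<open>comm_monoid_mult\<close>,
  so that powers, products over sets and multisets, and rearrangement by \<open>mult_ac\<close>
  become available.\<close>

typedef (overloaded) 'k even_mod_I' = "comp_mod_I' 0 :: 'k::{field, finite} jordan_mod_I' set"
  morphisms even_rep even_abs
  using one_in_comp by (auto simp: comp_mod_I'_def)

setup_lifting type_definition_even_mod_I'

instantiation even_mod_I' :: ("{field, finite}") comm_monoid_mult
begin

lift_definition one_even_mod_I' :: "'k::{field, finite} even_mod_I'" is 1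
  using one_in_comp by (auto simp: comp_mod_I'_def simp flip: coset_I'_one)

lift_definition times_even_mod_I' ::
  "'k::{field, finite} even_mod_I' \<Rightarrow> 'k even_mod_I' \<Rightarrow> 'k even_mod_I'" is "(*)"
  by (rule comp_mod_I'_mults)

instance
proof
  fix a b c :: "'k::{field, finite} even_mod_I'"
  show "a * b * c = a * (b * c)" by transfer (simp add: assoc_mod_I')
  show "a * b = b * a" by transfer (rule mult_commute_mod_I')
  show "1 * a = a" by transfer (rule one_mult_mod_I')
qed

end

lift_definition even_y :: "nat \<Rightarrow> 'k::{field, finite} even_mod_I'" is "\<lambda>i. coset_I' (yv i)"
  by (simp add: comp_mod_I'_def yv_in_comp)

lemma zv_mult_in_comp: "zv i * zv j \<in> jordan_comp 0"
  using jordan_comp_mult[OF zv_in_comp zv_in_comp, of i j] by simp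

lift_definition even_zz :: "nat \<Rightarrow> nat \<Rightarrow> 'k::{field, finite} even_mod_I'" is
  "\<lambda>i j. coset_I' (zv i * zv j)"
  by (simp add: comp_mod_I'_def zv_mult_in_comp)

lemma coset_zv_in_comp: "coset_I' (zv i) \<in> comp_mod_I' 1"
  unfolding comp_mod_I'_def by (rule imageI, rule zv_in_comp)

lemma even_zz_commute: "even_zz i j = even_zz j i"
  by transfer (simp add: jordan.mult_commute)

text \<open>Exchanges a letter of one pair with a letter of the other; together with
  \<open>even_zz_commute\<close> this generates all permutations of the four letters.\<close>

lemma even_zz_swap: "even_zz a b * even_zz c d = even_zz a d * even_zz b c"
  by transfer (unfold coset_I'_mult, intro odd_mult_symmetric coset_zv_in_comp)

lemma coset_lpow_yv: "coset_I' (lpow (yv i) n) = even_rep (even_y i ^ n)"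
  by (induction n)
    (simp_all add: coset_I'_one coset_I'_mult one_even_mod_I'.rep_eq times_even_mod_I'.rep_eq
      even_y.rep_eq mult_commute_mod_I')

lemma even_assoc:
  assumes "b \<in> comp_mod_I' 1" and "c \<in> comp_mod_I' 1"
  shows "even_rep a * b * c = even_rep a * (b * c)"
  using assms by (intro assoc_mod_I' even_rep) simp_all

lemma even_rep_mult_odd:
  assumes b: "b \<in> comp_mod_I' 1"
  shows "even_rep a * b \<in> comp_mod_I' 1" and "even_rep a * (even_rep a' * b) = even_rep (a * a') * b"
proof -
  show "even_rep a * b \<in> comp_mod_I' 1"
    using comp_mod_I'_mult[OF even_rep b, of a] by simp
  show "even_rep a * (even_rep a' * b) = even_rep (a * a') * b"
    using assoc_mod_I'[OF even_rep, of "even_rep a'" b a] b even_rep[of a']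
    by (simp add: times_even_mod_I'.rep_eq)
qed

lemmas even_zv_assoc = even_assoc[OF coset_zv_in_comp coset_zv_in_comp]

text \<open>An even left-normed power of an odd variable is even, hence associates with the next two
  factors; these join into one more pair \<open>z_i z_i\<close>.\<close>

lemma coset_lpow_zv:
  "(coset_I' (lpow (zv i) (2 * n)) :: 'k::{field, finite} jordan_mod_I') = even_rep (even_zz i i ^ n)"
proof (induction n)
  case (Suc n)
  have "(coset_I' (lpow (zv i) (2 * Suc n)) :: 'k jordan_mod_I')
      = even_rep (even_zz i i ^ n) * (coset_I' (zv i) * coset_I' (zv i))"
    by (simp add: coset_I'_mult Suc.IH even_zv_assoc)
  then show ?case
    by (simp add: times_even_mod_I'.rep_eq even_zz.rep_eq coset_I'_mult mult_commute_mod_I')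
qed (simp add: coset_I'_one one_even_mod_I'.rep_eq)

lemma even_y_power_card: "(even_y i :: 'k::{field, finite} even_mod_I') ^ CARD('k) = even_y i"
proof -
  have "coset_I' (lpow (yv i) CARD('k)) = (coset_I' (yv i) :: 'k jordan_mod_I')"
    using lpow_card_in_I'(1)[OF yv_in_comp[of i, where 'a = 'k]] by (simp add: coset_I'_eq_iff)
  then show ?thesis
    by (simp add: coset_lpow_yv even_y.rep_eq flip: even_rep_inject)
qed

text \<open>The last generator read inside the even part: in \<open>z_i^q z_j\<close> the first q -
  1 factors form \<open>n\<close> pairs, and the remaining two letters form one more.\<close>

lemma even_zz_power:
  assumes "CARD('k::{field, finite}) = 2 * n + 1"
  shows "(even_zz i i :: 'k even_mod_I') ^ n * even_zz i j = even_zz i j"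
proof -
  have "(lpow (zv i) CARD('k) - zv i) * zv j \<in> (I' :: 'k jordan set)"
    by (rule lpow_card_in_I'(2)[OF zv_in_comp zv_in_comp])
  then have "coset_I' (lpow (zv i) (2 * n) * zv i * zv j) = (coset_I' (zv i * zv j) :: 'k jordan_mod_I')"
    by (simp add: coset_I'_eq_iff assms diff_mult_jordan)
  then show ?thesis
    by (simp add: coset_I'_mult coset_lpow_zv even_zv_assoc even_zz.rep_eq
        times_even_mod_I'.rep_eq flip: even_rep_inject)
qed

section \<open>Products of pairs depend only on the multiset of letters\<close>

fun pair_prod :: "nat list \<Rightarrow> 'k::{field, finite} even_mod_I'" where
  "pair_prod (a # b # xs) = even_zz a b * pair_prod xs"
| "pair_prod _ = 1"

text \<open>A last letter without partner contributes 1 to \<open>pair_prod\<close>. The parity of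
  \<open>xs\<close> matters because after an odd prefix the concatenation is paired
  differently.\<close>

lemma pair_prod_append:
  "even (length xs) \<Longrightarrow> pair_prod (xs @ ys) = pair_prod xs * pair_prod ys"
  by (induction xs rule: pair_prod.induct) (simp_all add: mult.assoc)

text \<open>By induction \<open>x\<close> can be brought to the front of the tail; an exchange with
  the first pair then puts it at the head.\<close>

lemma pair_prod_move_first:
  assumes "even (length xs)" and "x \<in> set xs"
  shows "(pair_prod xs :: 'k::{field, finite} even_mod_I') = pair_prod (x # remove1 x xs)"
  using assms
proof (induction xs rule: pair_prod.induct)
  case (1 a b xs)
  show ?case
  proof (cases "x = a \<or> x = b")
    case True
    then show ?thesis by (auto simp: even_zz_commute)
  next
    case False
    with 1 have IH: "(pair_prod xs :: 'k even_mod_I') = pair_prod (x # remove1 x xs)"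
      and x: "x \<in> set xs" and len: "even (length xs)"
      by auto
    \<comment> \<open>A tail of even length containing \<open>x\<close> has another letter, which
      serves as the partner of \<open>x\<close>.\<close>
    have "odd (length (remove1 x xs))"
      using x len by (cases xs) (auto simp: length_remove1)
    then obtain c ys where r: "remove1 x xs = c # ys"
      by (cases "remove1 x xs") auto
    have "pair_prod (a # b # xs) = (even_zz a b * even_zz x c * pair_prod ys :: 'k even_mod_I')"
      by (simp add: IH r mult.assoc)
    also have "even_zz a b * even_zz x c = (even_zz x a * even_zz b c :: 'k even_mod_I')"
      by (metis even_zz_swap even_zz_commute)
    finally show ?thesis using False by (simp add: r mult.assoc)
  qed
qed simp_all

text \<open>With \<open>a\<close> kept in place, \<open>b\<close> is moved to the head of the
  remaining pairs and then exchanged with the partner of \<open>a\<close>.\<close>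

lemma pair_prod_move_second:
  assumes "odd (length xs)" and "b \<in> set xs"
  shows "(pair_prod (a # xs) :: 'k::{field, finite} even_mod_I') = pair_prod (a # b # remove1 b xs)"
proof (cases xs)
  case (Cons c ys)
  show ?thesis
  proof (cases "b = c")
    case False
    with Cons assms have b: "b \<in> set ys" and len: "even (length ys)" by auto
    have "odd (length (remove1 b ys))"
      using b len by (cases ys) (auto simp: length_remove1)
    then obtain d zs where r: "remove1 b ys = d # zs"
      by (cases "remove1 b ys") auto
    have "pair_prod (a # xs) = (even_zz a c * even_zz b d * pair_prod zs :: 'k even_mod_I')"
      by (simp add: Cons pair_prod_move_first[OF len b] r mult.assoc)
    also have "even_zz a c * even_zz b d = (even_zz a b * even_zz c d :: 'k even_mod_I')"
      by (metis even_zz_swap even_zz_commute)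
    finally show ?thesis using False by (simp add: Cons r mult.assoc)
  qed (simp add: Cons)
qed (use assms in simp)

text \<open>The two leading letters of \<open>xs\<close> are moved to the front of
  \<open>ys\<close>; then the tails are compared by induction.\<close>

lemma pair_prod_mset_cong:
  assumes "mset xs = mset ys" and "even (length xs)"
  shows "(pair_prod xs :: 'k::{field, finite} even_mod_I') = pair_prod ys"
  using assms
proof (induction xs arbitrary: ys rule: pair_prod.induct)
  case (1 a b xs)
  define ys' where "ys' = remove1 b (remove1 a ys)"
  have len: "length ys = length (a # b # xs)"
    using 1(2) by (metis size_mset)
  have a: "a \<in> set ys" using 1(2) by (metis list.set_intros(1) set_mset_mset)
  have ma: "mset (remove1 a ys) = mset (b # xs)" using 1(2) by simp (metis add_mset_remove_trivial)
  then have b: "b \<in> set (remove1 a ys)" by (metis list.set_intros(1) set_mset_mset)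
  have "mset ys' = mset (remove1 a ys) - {#b#}" by (simp add: ys'_def)
  then have "mset ys' = mset xs" by (simp only: ma) simp
  then have "pair_prod xs = (pair_prod ys' :: 'k even_mod_I')"
    using 1(1)[of ys'] 1(3) by simp
  moreover have "even (length ys)" "odd (length (remove1 a ys))"
    using len a 1(3) by (simp_all add: length_remove1)
  ultimately show ?case
    using pair_prod_move_first[OF _ a, where 'k = 'k] pair_prod_move_second[OF _ b, of a, where 'k = 'k]
    by (simp add: ys'_def)
qed simp_all

text \<open>If a letter \<open>i\<close> occurs at least \<open>2 * n + 1\<close> times, the letters
  can be rearranged to begin with \<open>n\<close> pairs \<open>z_i z_i\<close> and a pair
  \<open>z_i z_w\<close>. Then \<open>even_zz_power\<close> absorbs the \<open>n\<close> pairs, and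
  the list gets shorter.\<close>

lemma pair_prod_reduce:
  assumes "CHAR('k::{field, finite}) \<noteq> 2" and "even (length xs)"
  obtains ys where "even (length ys)" and "sorted ys" and "\<And>i. count (mset ys) i < CARD('k)"
    and "pair_prod ys = (pair_prod xs :: 'k even_mod_I')"
proof -
  obtain n where n: "CARD('k) = 2 * n + 1"
    using odd_card[OF assms(1)] by (rule oddE)
  have "n > 0" using n one_less_card[where 'k = 'k] by simp
  have "\<exists>ys. even (length ys) \<and> (\<forall>i. count (mset ys) i < CARD('k)) \<and>
      pair_prod ys = (pair_prod xs :: 'k even_mod_I')"
    using assms(2)
  proof (induction "length xs" arbitrary: xs rule: less_induct)
    case less
    show ?case
    proof (cases "\<forall>i. count (mset xs) i < CARD('k)")
      case False
      then obtain i where "replicate_mset CARD('k) i \<subseteq># mset xs"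
        by (auto simp: not_less simp flip: count_le_replicate_mset_subset_eq)
      then obtain N where N: "mset xs = replicate_mset CARD('k) i + N"
        by (metis subset_mset.le_iff_add)
      have "length xs = CARD('k) + size N"
        using arg_cong[OF N, of size] by simp
      \<comment> \<open>The length of \<open>xs\<close> is even and q is odd, so at least one letter
        \<open>w\<close> is left beside the q copies of \<open>i\<close>; it may be \<open>i\<close>
        again.\<close>
      then have "odd (size N)" using less.prems n by simp
      then obtain w R where R: "N = add_mset w R"
        by (cases N) auto
      obtain ws where ws: "mset ws = R" using ex_mset by blast
      define vs where "vs = replicate (2 * n) i @ i # w # ws"
      have vs: "mset xs = mset vs" by (simp add: N n R ws vs_def)
      then have len: "length xs = length vs" by (metis size_mset)
      have "pair_prod (replicate (2 * n) i) = (even_zz i i ^ n :: 'k even_mod_I')"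
        by (induction n) simp_all
      then have "pair_prod vs = (even_zz i i ^ n * even_zz i w * pair_prod ws :: 'k even_mod_I')"
        by (simp add: vs_def pair_prod_append mult.assoc)
      then have eq: "pair_prod xs = (pair_prod (i # w # ws) :: 'k even_mod_I')"
        using pair_prod_mset_cong[OF vs less.prems, where 'k = 'k] even_zz_power[OF n, of i w]
        by simp
      have "even (length (i # w # ws))" "length (i # w # ws) < length xs"
        using len less.prems \<open>n > 0\<close> by (auto simp: vs_def)
      then obtain ys where "even (length ys)" "\<forall>i. count (mset ys) i < CARD('k)"
        "pair_prod ys = (pair_prod (i # w # ws) :: 'k even_mod_I')"
        using less.hyps[of "i # w # ws"] by blast
      with eq show ?thesis by auto
    qed (use less.prems in blast)
  qed
  then obtain ys where ys: "even (length ys)" "\<And>i. count (mset ys) i < CARD('k)"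
    "pair_prod ys = (pair_prod xs :: 'k even_mod_I')"
    by blast
  have "pair_prod (sort ys) = (pair_prod xs :: 'k even_mod_I')"
    using pair_prod_mset_cong[of ys "sort ys", where 'k = 'k] ys(1,3) by simp
  with ys(1,2) show ?thesis by (intro that[of "sort ys"]) simp_all
qed

section \<open>Reduction of monomials to normal form modulo \<open>I'\<close>\<close>

lemma power_reduce:
  fixes x :: "'a::monoid_mult"
  assumes "x ^ q = x" and "q > 1"
  shows "\<exists>k<q. x ^ n = x ^ k"
proof (induction n rule: less_induct)
  case (less n)
  show ?case
  proof (cases "n < q")
    case False
    \<comment> \<open>One use of \<open>x ^ q = x\<close> lowers the exponent from \<open>n\<close>
      to \<open>n - q + 1\<close>, which is smaller because \<open>q > 1\<close>.\<close>
    then have "x ^ n = x ^ (n - q) * x ^ q" by (simp flip: power_add)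
    then have "x ^ n = x ^ Suc (n - q)" by (simp add: assms(1) power_commutes)
    moreover have "Suc (n - q) < n" using False assms(2) by simp
    ultimately show ?thesis using less.IH by metis
  qed blast
qed

lemma coset_Y_part: "coset_I' (monom_val (Y_part r k)) = even_rep (\<Prod>i<r. even_y i ^ k i)"
  by (induction r)
    (simp_all add: Y_part_def monom_val_lprod monom_val_lpow coset_I'_one coset_I'_mult one_monom_def
      one_even_mod_I'.rep_eq times_even_mod_I'.rep_eq coset_lpow_yv)

lemma coset_Z_part: "coset_I' (monom_val (Z_part ps)) = even_rep (pair_prod (unpair ps))"
proof -
  \<comment> \<open>The accumulator \<open>a\<close> of the left-normed product is kept general,
    since it changes in each induction step.\<close>
  have "coset_I' (foldl (*) a (map monom_val (map (\<lambda>(i, j). MVar (VZ i) * MVar (VZ j)) ps)))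
      = even_rep (u * pair_prod (unpair ps))"
    if "coset_I' a = even_rep u" for a :: "'a jordan" and u
    using that
  proof (induction ps arbitrary: a u)
    case (Cons p ps)
    obtain i j where p: "p = (i, j)" by (cases p)
    have "coset_I' (a * (zv i * zv j)) = even_rep (u * even_zz i j)"
      using Cons.prems by (simp add: coset_I'_mult[of a] times_even_mod_I'.rep_eq even_zz.rep_eq)
    from Cons.IH[OF this] show ?case by (simp add: p times_monom_def mult.assoc)
  qed simp
  from this[of 1 1] show ?thesis
    by (simp add: Z_part_def monom_val_lprod coset_I'_one one_even_mod_I'.rep_eq o_def)
qed

text \<open>The possible classes of monomials of even parity, still without bounds on the exponents;
  \<open>xs\<close> lists the z-letters, two for each pair.\<close>

definition even_monoms :: "'k::{field, finite} even_mod_I' set" where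
  "even_monoms = {(\<Prod>i\<in>#A. even_y i) * pair_prod xs | A xs. even (length xs)}"

lemma even_monoms_mult:
  assumes "a \<in> even_monoms" and "b \<in> even_monoms"
  shows "a * b \<in> even_monoms"
proof -
  from assms obtain A xs B ys where "even (length xs)" "even (length ys)"
    "a = (\<Prod>i\<in>#A. even_y i) * pair_prod xs" "b = (\<Prod>i\<in>#B. even_y i) * pair_prod ys"
    unfolding even_monoms_def by blast
  then show ?thesis
    unfolding even_monoms_def
    by (intro CollectI exI[of _ "A + B"] exI[of _ "xs @ ys"]) (simp add: pair_prod_append mult_ac)
qed

lemma one_in_even_monoms: "1 \<in> even_monoms"
  unfolding even_monoms_def by (intro CollectI exI[of _ "{#}"] exI[of _ "[]"]) simp

lemma even_y_in_even_monoms: "even_y i \<in> even_monoms"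
  unfolding even_monoms_def by (intro CollectI exI[of _ "{#i#}"] exI[of _ "[]"]) simp

lemma even_zz_in_even_monoms: "even_zz i j \<in> even_monoms"
  unfolding even_monoms_def by (intro CollectI exI[of _ "{#}"] exI[of _ "[i, j]"]) simp

text \<open>Bracketings become irrelevant by induction on the monomial: even factors multiply the
  coefficient, and two odd factors join their single z-letters into a new pair.\<close>

lemma coset_monom_val:
  "if monom_parity m = 0
   then \<exists>u \<in> even_monoms :: 'k::{field, finite} even_mod_I' set. coset_I' (monom_val m) = even_rep u
   else \<exists>u \<in> even_monoms :: 'k even_mod_I' set. \<exists>i.
     coset_I' (monom_val m) = even_rep u * coset_I' (zv i)"
proof (induction m)
  case MOne
  show ?case
    using one_in_even_monoms by (force simp: coset_I'_one one_even_mod_I'.rep_eq)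
next
  case (MVar x)
  show ?case
  proof (cases x)
    case (VY i)
    then show ?thesis using even_y_in_even_monoms by (force simp: even_y.rep_eq)
  next
    case (VZ i)
    have "coset_I' (zv i) = even_rep 1 * coset_I' (zv i)"
      by (simp add: one_even_mod_I'.rep_eq one_mult_mod_I')
    with VZ show ?thesis using one_in_even_monoms by auto
  qed
next
  case (MMult m m')
  have odd_odd: "even_rep u * coset_I' (zv i) * (even_rep v * coset_I' (zv j))
      = even_rep (u * v * even_zz i j)" for u v :: "'k even_mod_I'" and i j
  proof -
    have "even_rep u * coset_I' (zv i) * (even_rep v * coset_I' (zv j))
        = even_rep u * (coset_I' (zv i) * (even_rep v * coset_I' (zv j)))"
      by (intro even_assoc even_rep_mult_odd coset_zv_in_comp)
    also have "coset_I' (zv i) * (even_rep v * coset_I' (zv j))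
        = even_rep v * (coset_I' (zv j) * coset_I' (zv i))"
      by (simp add: mult_commute_mod_I'[of "coset_I' (zv i)"] even_zv_assoc)
    also have "\<dots> = even_rep (v * even_zz i j)"
      by (simp add: times_even_mod_I'.rep_eq even_zz.rep_eq coset_I'_mult mult_commute_mod_I')
    finally show ?thesis by (simp add: mult.assoc times_even_mod_I'.rep_eq)
  qed
  consider "monom_parity m = 0" "monom_parity m' = 0" | "monom_parity m = 0" "monom_parity m' = 1"
    | "monom_parity m = 1" "monom_parity m' = 0" | "monom_parity m = 1" "monom_parity m' = 1"
    using monom_parity_less[of m] monom_parity_less[of m'] by linarith
  then show ?case
  proof cases
    case 1
    then obtain u v :: "'k even_mod_I'" where uv: "u \<in> even_monoms" "v \<in> even_monoms"
      "coset_I' (monom_val m) = even_rep u" "coset_I' (monom_val m') = even_rep v"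
      using MMult.IH by auto
    then have "coset_I' (monom_val m * monom_val m') = even_rep (u * v)"
      by (simp add: coset_I'_mult times_even_mod_I'.rep_eq)
    with 1 even_monoms_mult[OF uv(1,2)] show ?thesis by auto
  next
    case 2
    then obtain u v :: "'k even_mod_I'" and i where uv: "u \<in> even_monoms" "v \<in> even_monoms"
      "coset_I' (monom_val m) = even_rep u" "coset_I' (monom_val m') = even_rep v * coset_I' (zv i)"
      using MMult.IH by auto
    then have "coset_I' (monom_val m * monom_val m') = even_rep (u * v) * coset_I' (zv i)"
      by (simp add: coset_I'_mult even_rep_mult_odd(2)[OF coset_zv_in_comp])
    with 2 even_monoms_mult[OF uv(1,2)] show ?thesis by auto
  next
    case 3
    then obtain u v :: "'k even_mod_I'" and i where uv: "u \<in> even_monoms" "v \<in> even_monoms"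
      "coset_I' (monom_val m) = even_rep u * coset_I' (zv i)" "coset_I' (monom_val m') = even_rep v"
      using MMult.IH by auto
    then have "coset_I' (monom_val m * monom_val m') = even_rep v * (even_rep u * coset_I' (zv i))"
      by (metis coset_I'_mult mult_commute_mod_I')
    also have "\<dots> = even_rep (v * u) * coset_I' (zv i)"
      by (rule even_rep_mult_odd[OF coset_zv_in_comp])
    finally show ?thesis using 3 even_monoms_mult[OF uv(2,1)] by auto
  next
    case 4
    then obtain u v :: "'k even_mod_I'" and i j where uv: "u \<in> even_monoms" "v \<in> even_monoms"
      "coset_I' (monom_val m) = even_rep u * coset_I' (zv i)"
      "coset_I' (monom_val m') = even_rep v * coset_I' (zv j)"
      using MMult.IH by auto
    then have "coset_I' (monom_val m * monom_val m') = even_rep (u * v * even_zz i j)"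
      by (simp add: coset_I'_mult odd_odd)
    with 4 even_monoms_mult[OF even_monoms_mult[OF uv(1,2)] even_zz_in_even_monoms]
    show ?thesis by auto
  qed
qed

lemma admissible_Z_iff:
  "admissible_Z q ps \<longleftrightarrow> sorted (unpair ps) \<and> (\<forall>i. count (mset (unpair ps)) i < q)"
  by (simp add: admissible_Z_def unpair_def[symmetric] monom_deg_Z_part)

text \<open>The exponents of the \<open>y_i\<close> are cut down by \<open>y_i^q = y_i\<close> and
  the z-letters by \<open>pair_prod_reduce\<close>, whose sorted result is split into pairs.\<close>

lemma even_monoms_normal_form:
  assumes char: "CHAR('k::{field, finite}) \<noteq> 2" and "(u :: 'k even_mod_I') \<in> even_monoms"
  obtains r k ps where "admissible_Y CARD('k) r k" and "admissible_Z CARD('k) ps"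
    and "even_rep u = coset_I' (monom_val (Y_part r k)) * coset_I' (monom_val (Z_part ps))"
proof -
  obtain A xs where xs: "even (length xs)" and u: "u = (\<Prod>i\<in>#A. even_y i) * pair_prod xs"
    using assms(2) unfolding even_monoms_def by blast
  \<comment> \<open>\<open>r\<close> exceeds all indices in \<open>A\<close>; indices below
    \<open>r\<close> that are absent from \<open>A\<close> enter with exponent 0.\<close>
  obtain r where "\<forall>i\<in>set_mset A. i < r"
    using finite_nat_set_iff_bounded[of "set_mset A"] by auto
  then have "(\<Prod>i\<in>#A. even_y i) = (\<Prod>i<r. even_y i ^ count A i :: 'k even_mod_I')"
    unfolding image_prod_mset_multiplicity
    by (intro prod.mono_neutral_left) (auto simp: not_in_iff)
  moreover have "\<forall>i. \<exists>k<CARD('k). (even_y i :: 'k even_mod_I') ^ count A i = even_y i ^ k"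
    using power_reduce[OF even_y_power_card one_less_card[where 'k = 'k]] by blast
  then obtain k where k: "\<And>i. k i < CARD('k)"
    "\<And>i. (even_y i :: 'k even_mod_I') ^ count A i = even_y i ^ k i"
    by metis
  ultimately have A: "(\<Prod>i\<in>#A. even_y i) = (\<Prod>i<r. even_y i ^ k i :: 'k even_mod_I')"
    by simp
  obtain ys where ys: "even (length ys)" "sorted ys" "\<And>i. count (mset ys) i < CARD('k)"
    "pair_prod ys = (pair_prod xs :: 'k even_mod_I')"
    using pair_prod_reduce[OF char xs] by metis
  obtain ps where "unpair ps = ys" using ex_unpair[OF ys(1)] by blast
  with ys k show ?thesis
    by (intro that[of r k ps])
      (simp_all add: admissible_Y_def admissible_Z_iff u A coset_Y_part coset_Z_part
        times_even_mod_I'.rep_eq)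
qed

text \<open>The parity of the monomial decides which of the two forms represents it; no linear
  combination is involved.\<close>

lemma coset_monom_val_in_S_hat:
  assumes char: "CHAR('k::{field, finite}) \<noteq> 2"
  shows "coset_I' (monom_val m :: 'k jordan) \<in> coset_I' ` S_hat"
proof (cases "monom_parity m = 0")
  case True
  then obtain u :: "'k even_mod_I'"
    where u: "u \<in> even_monoms" "coset_I' (monom_val m) = even_rep u"
    using coset_monom_val[of m] by auto
  obtain r k ps where rk: "admissible_Y CARD('k) r k" "admissible_Z CARD('k) ps"
    "even_rep u = coset_I' (monom_val (Y_part r k)) * coset_I' (monom_val (Z_part ps))"
    using even_monoms_normal_form[OF char u(1)] by metis
  then have eq: "coset_I' (monom_val (Y_part r k * Z_part ps))
      = (coset_I' (monom_val m) :: 'k jordan_mod_I')"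
    by (simp add: u(2) rk(3) times_monom_def coset_I'_mult)
  have "monom_val (Y_part r k * Z_part ps) \<in> (S_hat :: 'k jordan set)"
    using rk(1,2) unfolding S_hat_def by blast
  then show ?thesis by (rule rev_image_eqI) (simp add: eq)
next
  case False
  then obtain u :: "'k even_mod_I'" and i
    where u: "u \<in> even_monoms" "coset_I' (monom_val m) = even_rep u * coset_I' (zv i)"
    using coset_monom_val[of m] by auto
  obtain r k ps where rk: "admissible_Y CARD('k) r k" "admissible_Z CARD('k) ps"
    "even_rep u = coset_I' (monom_val (Y_part r k)) * coset_I' (monom_val (Z_part ps))"
    using even_monoms_normal_form[OF char u(1)] by metis
  have "coset_I' (monom_val (Y_part r k * (MVar (VZ i) * Z_part ps)))
      = even_rep (\<Prod>i<r. even_y i ^ k i :: 'k even_mod_I') *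
        (even_rep (pair_prod (unpair ps)) * coset_I' (zv i))"
    by (simp add: times_monom_def coset_I'_mult coset_Y_part coset_Z_part mult_commute_mod_I')
  also have "\<dots> = coset_I' (monom_val m)"
    by (simp add: u(2) rk(3) coset_Y_part coset_Z_part even_rep_mult_odd(2)[OF coset_zv_in_comp]
        times_even_mod_I'.rep_eq)
  finally have eq: "coset_I' (monom_val (Y_part r k * (MVar (VZ i) * Z_part ps)))
      = (coset_I' (monom_val m) :: 'k jordan_mod_I')" .
  have "monom_val (Y_part r k * (MVar (VZ i) * Z_part ps)) \<in> (S_hat :: 'k jordan set)"
    using rk(1,2) unfolding S_hat_def by blast
  then show ?thesis by (rule rev_image_eqI) (simp add: eq)
qed

lemma span_coset_S_hat:
  assumes "CHAR('k::{field, finite}) \<noteq> 2"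
  shows "mod_I'.span (coset_I' ` (S_hat :: 'k jordan set)) = UNIV"
proof -
  interpret Vector_Spaces.linear jscale scale_mod_I' "coset_I' :: 'k jordan \<Rightarrow> _"
    by (rule linear_coset_I')
  have "a \<in> range coset_I'" for a :: "'k jordan_mod_I'"
    by (induction a) (rule rangeI)
  then have "(UNIV :: 'k jordan_mod_I' set) = coset_I' ` UNIV" by blast
  also have "\<dots> = mod_I'.span (coset_I' ` range monom_val)"
    by (simp add: span_image span_monom_val)
  also have "\<dots> \<subseteq> mod_I'.span (coset_I' ` S_hat)"
    using coset_monom_val_in_S_hat[OF assms] by (intro mod_I'.span_mono) blast
  finally show ?thesis by blast
qed

section \<open>Independence of the normal forms\<close>

text \<open>The value of a monomial in commuting scalars: \<open>w\<close> supplies the scalar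
  \<alpha>_i for \<open>VY i\<close> and the diagonal entry b_i for \<open>VZ i\<close>.\<close>

primrec monom_eval :: "(var \<Rightarrow> 'k::field) \<Rightarrow> monom \<Rightarrow> 'k" where
  "monom_eval w MOne = 1"
| "monom_eval w (MVar x) = w x"
| "monom_eval w (MMult m m') = monom_eval w m * monom_eval w m'"

lemma monom_eval_eq_prod:
  assumes "finite V" and "{x. monom_deg x m \<noteq> 0} \<subseteq> V"
  shows "monom_eval w m = (\<Prod>x\<in>V. w x ^ monom_deg x m)"
  using assms(2)
proof (induction m)
  case (MVar x)
  then have "x \<in> V" by auto
  have "(\<Prod>y\<in>V. w y ^ monom_deg y (MVar x)) = (\<Prod>y\<in>V. if x = y then w y else 1)"
    by (rule prod.cong) auto
  with assms(1) \<open>x \<in> V\<close> show ?case by simp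
next
  case (MMult m m')
  then have "{x. monom_deg x m \<noteq> 0} \<subseteq> V" "{x. monom_deg x m' \<noteq> 0} \<subseteq> V" by auto
  with MMult.IH show ?case by (simp add: power_add prod.distrib)
qed simp

lemma finite_monom_vars: "finite {x. monom_deg x m \<noteq> 0}"
proof (induction m)
  case (MMult m m')
  then show ?case by (simp add: Collect_disj_eq)
qed simp_all

text \<open>The scalar matrix of an even monomial is independent of \<open>c\<close>, as products of
  two odd matrices see only the diagonals. The values \<open>c i\<close> thus stay free for
  separating the odd normal forms.\<close>

lemma ex_graded_subst:
  fixes w :: "var \<Rightarrow> 'k::field"
  assumes char: "CHAR('k) \<noteq> 2"
  obtains \<phi> where "graded_subst \<phi>" and "\<And>i. \<phi> (zv i) = odd_mat (w (VZ i)) (c i)"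
    and "\<And>m. monom_parity m = 0 \<Longrightarrow> \<phi> (monom_val m) = mat (monom_eval w m)"
proof -
  define g where "g x = (case x of VY i \<Rightarrow> mat (w x) | VZ i \<Rightarrow> odd_mat (w x) (c i))" for x
  have "g (VY i) \<in> UJ2_even" "g (VZ i) \<in> UJ2_odd" for i
    by (auto simp: g_def UJ2_even_eq UJ2_odd_eq)
  then obtain \<phi> where \<phi>: "graded_subst \<phi>" and var: "\<And>x. \<phi> (jvar x) = g x"
    using ex_graded_substitution[OF char, of g] by (metis graded_subst_def)
  have "if monom_parity m = 0 then \<phi> (monom_val m) = mat (monom_eval w m)
      else \<exists>t. \<phi> (monom_val m) = odd_mat (monom_eval w m) t" for m
  proof (induction m)
    case (MVar x)
    then show ?case by (cases x) (auto simp: var g_def)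
  next
    case (MMult m m')
    then show ?case
      using monom_parity_less[of m] monom_parity_less[of m']
      by (auto simp: graded_subst_simps[OF \<phi>] mat_jmult_simps[OF char] less_2_cases_iff mult_ac
          split: if_splits)
  qed (simp add: graded_subst_simps[OF \<phi>])
  then have "\<phi> (monom_val m) = mat (monom_eval w m)" if "monom_parity m = 0" for m
    using that by metis
  with \<phi> show ?thesis by (intro that[of \<phi>]) (simp_all add: var g_def)
qed

lemma monom_deg_YZ_less:
  assumes "admissible_Y q r k" and "admissible_Z q ps" and "q > 0"
  shows "monom_deg x (Y_part r k * Z_part ps) < q"
  using assms
  by (cases x) (auto simp: times_monom_def monom_deg_Y_part monom_deg_Z_part admissible_Y_def
      admissible_Z_iff)

text \<open>The index set \<open>G\<close> is abstract so that both forms of normal form are served.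
  Degrees determine the value of the Y-part and the list of pairs, so by \<open>inj\<close> distinct
  indices have distinct degrees.\<close>

lemma YZ_monomials_independent:
  fixes a :: "'g \<Rightarrow> 'k::{field, finite}"
  assumes "finite G"
    and adm: "\<And>g. g \<in> G \<Longrightarrow> admissible_Y CARD('k) (\<rho> g) (\<kappa> g) \<and> admissible_Z CARD('k) (\<pi> g)"
    and inj: "\<And>g h. \<lbrakk>g \<in> G; h \<in> G; \<pi> g = \<pi> h;
      (monom_val (Y_part (\<rho> g) (\<kappa> g)) :: 'k jordan) = monom_val (Y_part (\<rho> h) (\<kappa> h))\<rbrakk> \<Longrightarrow> g = h"
    and zero: "\<And>w. (\<Sum>g\<in>G. a g * monom_eval w (Y_part (\<rho> g) (\<kappa> g) * Z_part (\<pi> g))) = 0"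
    and "g \<in> G"
  shows "a g = 0"
proof -
  define m where "m g = Y_part (\<rho> g) (\<kappa> g) * Z_part (\<pi> g)" for g
  define V where "V = (\<Union>g\<in>G. {x. monom_deg x (m g) \<noteq> 0})"
  show ?thesis
  proof (rule reduced_monomials_independent[where G = G and V = V
        and e = "\<lambda>g x. monom_deg x (m g)"])
    show V: "finite V" using assms(1) finite_monom_vars by (auto simp: V_def)
    show "finite G" "g \<in> G" by fact+
    show "monom_deg x (m g) < CARD('k)" if "g \<in> G" for g x
      unfolding m_def using adm[OF that] by (simp add: monom_deg_YZ_less)
    show "(\<Sum>g\<in>G. a g * (\<Prod>x\<in>V. w x ^ monom_deg x (m g))) = 0" for w
    proof -
      have "(\<Prod>x\<in>V. w x ^ monom_deg x (m g)) = monom_eval w (m g)" if "g \<in> G" for g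
        using that V by (intro monom_eval_eq_prod[symmetric]) (auto simp: V_def)
      then show ?thesis using zero[of w] by (simp add: m_def)
    qed
    show "g = h" if gh: "g \<in> G" "h \<in> G" and eq: "\<forall>x\<in>V. monom_deg x (m g) = monom_deg x (m h)" for g h
    proof -
      have "monom_deg x (m g) = monom_deg x (m h)" for x
      proof (cases "x \<in> V")
        case False
        with gh show ?thesis by (auto simp: V_def)
      qed (use eq in simp)
      then have "monom_deg x (Y_part (\<rho> g) (\<kappa> g)) + monom_deg x (Z_part (\<pi> g))
          = monom_deg x (Y_part (\<rho> h) (\<kappa> h)) + monom_deg x (Z_part (\<pi> h))" for x
        by (simp add: m_def times_monom_def)
      from YZ_part_eqI[OF this, where 'k = 'k] gh adm inj show ?thesis
        by (simp add: admissible_Z_iff)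
    qed
  qed
qed

text \<open>The trace isolates the elements of form (a), because those of form (b) are traceless and
  \<open>2 \<noteq> 0\<close>. Afterwards the (1,2)-entry isolates the elements of form (b) one
  distinguished letter at a time.\<close>

lemma S_hat_independent:
  fixes a :: "'k::{field, finite} jordan \<Rightarrow> 'k"
  assumes char: "CHAR('k) \<noteq> 2"
    and F: "finite F" "F \<subseteq> S_hat" and zero: "(\<Sum>g\<in>F. jscale (a g) g) \<in> T_Sca" and "g \<in> F"
  shows "a g = 0"
proof -
  have entry: "(\<Sum>g\<in>F. a g * \<phi> g $ i $ j) = 0" if "graded_subst \<phi>" for \<phi> i j
  proof -
    have "(\<Sum>g\<in>F. mat_scale (a g) (\<phi> g)) = 0"
      using zero that unfolding T_Sca_iff
      by (simp flip: graded_subst_simps(6,7)[OF that])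
    then have "(\<Sum>g\<in>F. mat_scale (a g) (\<phi> g)) $ i $ j = 0" by simp
    then show ?thesis by simp
  qed
  \<comment> \<open>Form (a) is given preference: \<open>A\<close> takes every element with such a
    representation, and the rest of \<open>F\<close> must then have form (b).\<close>
  define A where "A = {g \<in> F. \<exists>r k ps. admissible_Y CARD('k) r k \<and> admissible_Z CARD('k) ps \<and>
    g = monom_val (Y_part r k * Z_part ps)}"
  have "\<forall>g\<in>A. \<exists>r k ps. admissible_Y CARD('k) r k \<and> admissible_Z CARD('k) ps \<and>
      g = monom_val (Y_part r k * Z_part ps)"
    by (simp add: A_def)
  then obtain \<rho> \<kappa> \<pi> where A: "\<And>g. g \<in> A \<Longrightarrow> admissible_Y CARD('k) (\<rho> g) (\<kappa> g) \<and>
      admissible_Z CARD('k) (\<pi> g) \<and> g = monom_val (Y_part (\<rho> g) (\<kappa> g) * Z_part (\<pi> g))"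
    by metis
  have "\<forall>g\<in>F - A. \<exists>i r k ps. admissible_Y CARD('k) r k \<and> admissible_Z CARD('k) ps \<and>
      g = monom_val (Y_part r k * (MVar (VZ i) * Z_part ps))"
  proof
    fix g assume "g \<in> F - A"
    with F(2) have "g \<in> S_hat" "g \<notin> A" "g \<in> F" by auto
    then show "\<exists>i r k ps. admissible_Y CARD('k) r k \<and> admissible_Z CARD('k) ps \<and>
        g = monom_val (Y_part r k * (MVar (VZ i) * Z_part ps))"
      unfolding S_hat_def A_def by blast
  qed
  then obtain \<iota> \<rho>' \<kappa>' \<pi>' where B: "\<And>g. g \<in> F - A \<Longrightarrow> admissible_Y CARD('k) (\<rho>' g) (\<kappa>' g) \<and>
      admissible_Z CARD('k) (\<pi>' g) \<and>
      g = monom_val (Y_part (\<rho>' g) (\<kappa>' g) * (MVar (VZ (\<iota> g)) * Z_part (\<pi>' g)))"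
    by metis
  have "A \<subseteq> F" by (auto simp: A_def)
  \<comment> \<open>The even factors act as scalars on the matrix of the distinguished
    letter.\<close>
  have odd: "\<phi> g = odd_mat (w (VZ (\<iota> g)) * monom_eval w (Y_part (\<rho>' g) (\<kappa>' g) * Z_part (\<pi>' g)))
      (c (\<iota> g) * monom_eval w (Y_part (\<rho>' g) (\<kappa>' g) * Z_part (\<pi>' g)))"
    if g: "g \<in> F - A" and "graded_subst \<phi>" "\<And>i. \<phi> (zv i) = odd_mat (w (VZ i)) (c i)"
      "\<And>m. monom_parity m = 0 \<Longrightarrow> \<phi> (monom_val m) = mat (monom_eval w m)" for g \<phi> w c
  proof -
    have "\<phi> g = \<phi> (monom_val (Y_part (\<rho>' g) (\<kappa>' g) * (MVar (VZ (\<iota> g)) * Z_part (\<pi>' g))))"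
      using B[OF g] by simp
    then show ?thesis
      by (simp add: times_monom_def graded_subst_simps[OF that(2)] that(3,4) monom_parity_Y_part
          monom_parity_Z_part mat_jmult_simps[OF char] mult_ac)
  qed
  have A0: "a g = 0" if "g \<in> A" for g
  proof (rule YZ_monomials_independent[where G = A])
    show "finite A" using F(1) \<open>A \<subseteq> F\<close> by (rule finite_subset[rotated])
    show "g \<in> A" by fact
    show "admissible_Y CARD('k) (\<rho> g) (\<kappa> g) \<and> admissible_Z CARD('k) (\<pi> g)" if "g \<in> A" for g
      using A[OF that] by blast
    show "g = h" if "g \<in> A" "h \<in> A" "\<pi> g = \<pi> h"
      "(monom_val (Y_part (\<rho> g) (\<kappa> g)) :: 'k jordan) = monom_val (Y_part (\<rho> h) (\<kappa> h))" for g h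
      using A[OF that(1)] A[OF that(2)] that(3,4) by (metis monom_val.simps(3) times_monom_def)
    fix w :: "var \<Rightarrow> 'k"
    \<comment> \<open>The trace does not involve the (1,2)-entries, so they are all set to
      0.\<close>
    obtain \<phi> where \<phi>: "graded_subst \<phi>" "\<And>i. \<phi> (zv i) = odd_mat (w (VZ i)) 0"
      "\<And>m. monom_parity m = 0 \<Longrightarrow> \<phi> (monom_val m) = mat (monom_eval w m)"
      using ex_graded_subst[OF char, of w "\<lambda>_. 0"] by metis
    have tr: "\<phi> g $ 1 $ 1 + \<phi> g $ 2 $ 2
        = (if g \<in> A then 2 * monom_eval w (Y_part (\<rho> g) (\<kappa> g) * Z_part (\<pi> g)) else 0)"
      if "g \<in> F" for g
    proof (cases "g \<in> A")
      case True
      have "\<phi> g = \<phi> (monom_val (Y_part (\<rho> g) (\<kappa> g) * Z_part (\<pi> g)))"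
        using A[OF True] by simp
      also have "\<dots> = mat (monom_eval w (Y_part (\<rho> g) (\<kappa> g) * Z_part (\<pi> g)))"
        by (rule \<phi>(3)) (simp add: times_monom_def monom_parity_Y_part monom_parity_Z_part)
      finally show ?thesis using True by simp
    next
      case False
      with that odd[OF _ \<phi>, of g] show ?thesis by simp
    qed
    have "0 = (\<Sum>g\<in>F. a g * (\<phi> g $ 1 $ 1 + \<phi> g $ 2 $ 2))"
      using entry[OF \<phi>(1), of 1 1] entry[OF \<phi>(1), of 2 2] by (simp add: distrib_left sum.distrib)
    also have "\<dots> = (\<Sum>g\<in>F. if g \<in> A
        then 2 * (a g * monom_eval w (Y_part (\<rho> g) (\<kappa> g) * Z_part (\<pi> g))) else 0)"
      by (rule sum.cong) (simp_all add: tr)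
    also have "\<dots> = 2 * (\<Sum>g\<in>A. a g * monom_eval w (Y_part (\<rho> g) (\<kappa> g) * Z_part (\<pi> g)))"
      using F(1) \<open>A \<subseteq> F\<close> by (simp add: sum.If_cases Int_absorb1 sum_distrib_left)
    finally show "(\<Sum>g\<in>A. a g * monom_eval w (Y_part (\<rho> g) (\<kappa> g) * Z_part (\<pi> g))) = 0"
      using two_neq_zero[OF char] by simp
  qed
  show ?thesis
  proof (cases "g \<in> A")
    case False
    define G where "G = {h \<in> F - A. \<iota> h = \<iota> g}"
    show ?thesis
    proof (rule YZ_monomials_independent[where G = G])
      show "finite G" using F(1) by (simp add: G_def)
      show "g \<in> G" using \<open>g \<in> F\<close> False by (simp add: G_def)
      show "admissible_Y CARD('k) (\<rho>' h) (\<kappa>' h) \<and> admissible_Z CARD('k) (\<pi>' h)" if "h \<in> G" for h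
        using B[of h] that by (simp add: G_def)
      show "h = h'" if "h \<in> G" "h' \<in> G" "\<pi>' h = \<pi>' h'"
        "(monom_val (Y_part (\<rho>' h) (\<kappa>' h)) :: 'k jordan) = monom_val (Y_part (\<rho>' h') (\<kappa>' h'))"
        for h h'
        using B[of h] B[of h'] that unfolding G_def mem_Collect_eq
        by (metis monom_val.simps(3) times_monom_def)
      fix w :: "var \<Rightarrow> 'k"
      \<comment> \<open>With \<open>c\<close> equal to 1 at \<open>\<iota> g\<close> and 0
        elsewhere, the (1,2)-entry vanishes on elements of form (b) with another distinguished
        letter; those of form (a) already have coefficient 0.\<close>
      obtain \<phi> where \<phi>: "graded_subst \<phi>"
        "\<And>i. \<phi> (zv i) = odd_mat (w (VZ i)) (if i = \<iota> g then 1 else 0)"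
        "\<And>m. monom_parity m = 0 \<Longrightarrow> \<phi> (monom_val m) = mat (monom_eval w m)"
        using ex_graded_subst[OF char, of w "\<lambda>i. if i = \<iota> g then 1 else 0"] by metis
      have "0 = (\<Sum>h\<in>F. a h * \<phi> h $ 1 $ 2)"
        using entry[OF \<phi>(1), of 1 2] by simp
      also have "\<dots> = (\<Sum>h\<in>F. if h \<in> G
          then a h * monom_eval w (Y_part (\<rho>' h) (\<kappa>' h) * Z_part (\<pi>' h)) else 0)"
      proof (rule sum.cong[OF HOL.refl])
        fix h assume "h \<in> F"
        then show "a h * \<phi> h $ 1 $ 2 = (if h \<in> G
            then a h * monom_eval w (Y_part (\<rho>' h) (\<kappa>' h) * Z_part (\<pi>' h)) else 0)"
          using A0[of h] odd[OF _ \<phi>, of h] by (cases "h \<in> A") (auto simp: G_def)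
      qed
      also have "\<dots> = (\<Sum>h\<in>G. a h * monom_eval w (Y_part (\<rho>' h) (\<kappa>' h) * Z_part (\<pi>' h)))"
        using F(1) by (subst sum.inter_restrict[symmetric]) (auto simp: G_def intro!: sum.cong)
      finally show "(\<Sum>h\<in>G. a h * monom_eval w (Y_part (\<rho>' h) (\<kappa>' h) * Z_part (\<pi>' h))) = 0"
        by simp
    qed
  qed (rule A0)
qed

section \<open>The basis of the quotient and the equality of the two ideals\<close>

lemma coset_sum_eq:
  "(\<Sum>g\<in>F. scale_mod_I' (a g) (coset_I' g)) = coset_I' (\<Sum>g\<in>F. jscale (a g) g)"
proof -
  interpret Vector_Spaces.linear jscale scale_mod_I' coset_I'
    by (rule linear_coset_I')
  show ?thesis by (simp add: sum scale)
qed

lemma coset_eq_0_iff: "coset_I' a = 0 \<longleftrightarrow> a \<in> I'"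
  by (simp add: zero_jordan_mod_I'_def coset_I'_eq_iff)

theorem theorem4p12:
  assumes "CHAR('k::{field, finite}) \<noteq> 2"
  shows "(I' :: 'k jordan set) = T_Sca \<and>
    inj_on coset_I' (S_hat :: 'k jordan set) \<and>
    mod_I'.independent (coset_I' ` (S_hat :: 'k jordan set)) \<and>
    mod_I'.span (coset_I' ` (S_hat :: 'k jordan set)) = UNIV"
proof (intro conjI)
  note sub = I'_subset_T_Sca[OF assms]
  show span: "mod_I'.span (coset_I' ` (S_hat :: 'k jordan set)) = UNIV"
    by (rule span_coset_S_hat[OF assms])
  show inj: "inj_on coset_I' (S_hat :: 'k jordan set)"
  proof (rule inj_onI, rule ccontr)
    fix g h :: "'k jordan" assume gh: "g \<in> S_hat" "h \<in> S_hat" "coset_I' g = coset_I' h" "g \<noteq> h"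
    \<comment> \<open>Two distinct elements of \<open>S_hat\<close> with the same coset would give
      the relation \<open>g - h\<close> in \<open>T_Sca\<close>, with coefficients 1 and -1.\<close>
    define a :: "'k jordan \<Rightarrow> 'k" where "a x = (if x = g then 1 else - 1)" for x
    have "(\<Sum>x\<in>{g, h}. jscale (a x) x) = g - h"
      using gh(4) by (simp add: a_def)
    also have "g - h \<in> T_Sca" using gh(3) sub by (auto simp: coset_I'_eq_iff)
    finally have "a g = 0"
      using gh(1,2) by (intro S_hat_independent[OF assms, of "{g, h}"]) auto
    then show False by (simp add: a_def)
  qed
  show "mod_I'.independent (coset_I' ` (S_hat :: 'k jordan set))"
    unfolding mod_I'.independent_explicit_module
  proof (intro allI impI)
    fix T and u :: "'k jordan_mod_I' \<Rightarrow> 'k" and v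
    assume T: "finite T" "T \<subseteq> coset_I' ` S_hat" "(\<Sum>v\<in>T. scale_mod_I' (u v) v) = 0" "v \<in> T"
    then obtain F where F: "F \<subseteq> S_hat" "finite F" "T = coset_I' ` F"
      by (meson finite_subset_image)
    \<comment> \<open>By injectivity the relation between cosets lifts to a combination of elements
      of \<open>S_hat\<close>, which lies in \<open>I'\<close> and hence in
      \<open>T_Sca\<close>.\<close>
    have "inj_on coset_I' F" using inj F(1) by (rule inj_on_subset)
    then have "coset_I' (\<Sum>g\<in>F. jscale (u (coset_I' g)) g) = 0"
      using T(3) by (simp add: F(3) sum.reindex flip: coset_sum_eq)
    then have *: "(\<Sum>g\<in>F. jscale (u (coset_I' g)) g) \<in> T_Sca"
      using sub by (auto simp: coset_eq_0_iff)
    from T(4) obtain g where "g \<in> F" "v = coset_I' g" by (auto simp: F(3))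
    then show "u v = 0" using S_hat_independent[OF assms F(2,1) *] by simp
  qed
  show "(I' :: 'k jordan set) = T_Sca"
  proof (intro equalityI sub subsetI)
    fix f :: "'k jordan" assume f: "f \<in> T_Sca"
    \<comment> \<open>Modulo \<open>I'\<close> the identity \<open>f\<close> is a combination
      \<open>s\<close> of normal forms. Since \<open>f - s\<close> lies in \<open>I'\<close> and
      hence in \<open>T_Sca\<close>, \<open>s\<close> is an identity too, and independence forces
      \<open>s = 0\<close>.\<close>
    have "coset_I' f \<in> mod_I'.span (coset_I' ` S_hat)" by (simp add: span)
    then obtain T u where T: "finite T" "T \<subseteq> coset_I' ` S_hat"
      "coset_I' f = (\<Sum>v\<in>T. scale_mod_I' (u v) v)"
      by (auto simp: mod_I'.span_explicit)
    then obtain F where F: "F \<subseteq> S_hat" "finite F" "T = coset_I' ` F"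
      by (meson finite_subset_image)
    define s where "s = (\<Sum>g\<in>F. jscale (u (coset_I' g)) g)"
    have "inj_on coset_I' F" using inj F(1) by (rule inj_on_subset)
    then have "coset_I' f = coset_I' s"
      using T(3) by (simp add: F(3) sum.reindex s_def coset_sum_eq)
    then have fs: "f - s \<in> I'" by (simp add: coset_I'_eq_iff)
    have "jordan.subspace (T_Sca :: 'k jordan set)"
      using graded_T_ideal_T_Sca[OF assms] by (simp add: graded_T_ideal_def jordan_ideal_def)
    from jordan.subspace_diff[OF this f] have "f - (f - s) \<in> T_Sca"
      using fs sub by blast
    then have "s \<in> T_Sca" by simp
    then have "u (coset_I' g) = 0" if "g \<in> F" for g
      using S_hat_independent[OF assms F(2,1) _ that] by (simp add: s_def)
    then have "s = 0" by (simp add: s_def)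
    with fs show "f \<in> I'" by simp
  qed
qed

end
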